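(* Assume $X$ is Calabi-Yau, i.e. $\sum_{i=1}^k d_i=n+1$. Let $\{u_\alpha:\alpha\in I\}\subset\mathcal{A}_0^0$ be weight-homogeneous elements whose classes form a $\mathbb{C}$-basis of $\mathcal{A}_0^0/Q_S(\mathcal{A}_0^{-1})$, with $u_{\max}$ the unique basis element of weight $n-k$, and $L=\sum_\alpha t^\alpha u_\alpha$. Identify $T_{\mathbb{H}}(\!(\hbar)\!)$ with $J=\mathcal{A}_0^0[\![\underline t]\!](\!(\hbar)\!)/Q_S(\mathcal{A}_0^{-1}[\![\underline t]\!](\!(\hbar)\!))$ via $\Phi$. For $[w_i]=[\Phi(u_i)]$ with $u_1,u_2\in\mathcal{A}_0^0[\![\underline t]\!](\!(\hbar)\!)$ define $$K([w_1],[w_2]):=\mathbf{A}_{u_1u_2^*}{}^{\max}\in\mathbb{C}[\![\underline t]\!](\!(\hbar)\!),$$ where $\mathbf{A}_{u_1u_2^*}{}^\rho\in\mathbb{C}[\![\underline t]\!](\!(\hbar)\!)$ are the unique coefficients with $u_1u_2^*=\sum_{\rho\in I}\mathbf{A}_{u_1u_2^*}{}^\rho u_\rho+Q_S(\mathbf{\Lambda}_{u_1u_2^*})$ for some $\mathbf{\Lambda}_{u_1u_2^*}\in\mathcal{A}_0^{-1}[\![\underline t]\!](\!(\hbar)\!)$. Then $K:T_{\mathbb{H}}(\!(\hbar)\!)\times T_{\mathbb{H}}(\!(\hbar)\!)\to\mathbb{C}[\![\underline t]\!](\!(\hbar)\!)$ is a modified higher residue pairing.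
   Context: Let $n\ge k\ge1$ and let $G_1,\dots,G_k\in\mathbb{C}[x_0,\dots,x_n]$ be homogeneous of degrees $d_1,\dots,d_k$ defining a smooth complete intersection $X\subset\mathbf{P}^n$ of dimension $n-k$. Put $N=n+k+1$, $(q_1,\dots,q_N)=(y_1,\dots,y_k,x_0,\dots,x_n)$, $S=\sum_{\ell=1}^k y_\ell G_\ell(\underline x)$. Let $\mathcal{A}=\mathbb{C}[q_1,\dots,q_N][\eta_1,\dots,\eta_N]$ be the $\mathbb{Z}$-graded super-commutative algebra with $|q_i|=0$, $|\eta_i|=-1$ (so $\eta_i\eta_j=-\eta_j\eta_i$), $\mathcal{A}^j$ its degree $j$ part, and $Q_S=\sum_{i=1}^N\frac{\partial S}{\partial q_i}\frac{\partial}{\partial\eta_i}$. Charge grading: $ch(y_i)=-d_i$, $ch(x_j)=1$, $ch(\eta_i)=-ch(q_i)$; $\mathcal{A}_0^j$ is the charge $0$ part of $\mathcal{A}^j$. Weight grading: $wt(y_i)=1$, $wt(x_j)=0$, $wt(\eta_i)=1-wt(q_i)$. In the Calabi-Yau case $\mathcal{A}_0^0/Q_S(\mathcal{A}_0^{-1})$ is finite-dimensional with one-dimensional weight $n-k$ part, and there is a $\mathbb{C}$-linear isomorphism $\Phi:\mathcal{A}_0^0/Q_S(\mathcal{A}_0^{-1})\to\mathbb{H}=H^{n-k}_{\mathrm{prim}}(X,\mathbb{C})$, extended linearly over power/Laurent series. $T_{\mathbb{H}}\simeq\mathbb{H}[\![\underline t]\!]$ is the space of formal tangent vector fields on $\mathbb{H}$,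 with formal coordinates $\underline t=(t^\alpha)_{\alpha\in I}$; $\partial_\alpha=\partial/\partial t^\alpha$; $\hbar$ is a formal variable. For a Laurent series $F(\hbar)$ put $F^*(\hbar)=F(-\hbar)$. On $J$ (hence on $T_{\mathbb{H}}(\!(\hbar)\!)$) the connections $\nabla_\alpha[w]=[\partial_\alpha w+\hbar^{-1}u_\alpha w]$ and $\nabla_{\hbar^{-1}}[w]=[\partial_{\hbar^{-1}}w+(S+L)w]$ are well defined, where $\partial_{\hbar^{-1}}=-\hbar^2\partial_\hbar$. Let $\eta:T_{\mathbb{H}}\times T_{\mathbb{H}}\to\mathbb{C}[\![\underline t]\!]$ be the symmetric $\mathbb{C}[\![\underline t]\!]$-bilinear pairing $\eta([\Phi(u_1)],[\Phi(u_2)])=A_{u_1u_2}{}^{\max}$ for $u_1,u_2\in\mathcal{A}_0^0[\![\underline t]\!]$, where $u_1u_2=\sum_\rho A_{u_1u_2}{}^\rho u_\rho+Q_S(\Lambda)$ with $A_{u_1u_2}{}^\rho\in\mathbb{C}[\![\underline t]\!]$, $\Lambda\in\mathcal{A}_0^{-1}[\![\underline t]\!]$ (at $\underline t=0$ this is, up to a numerical factor, the cup product pairing on $\mathbb{H}$, by a theorem of Konno). A modified higher residue pairing is a $\mathbb{C}[\![\underline t]\!]$-bilinear pairing $K:T_{\mathbb{H}}(\!(\hbar)\!)\times T_{\mathbb{H}}(\!(\hbar)\!)\to\mathbb{C}[\![\underline t]\!](\!(\hbar)\!)$ such that, for all $w_1,w_2$: (H1) $K(w_1,w_2)=K(w_2,w_1)^*$;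 (H2) $g(\hbar)K(w_1,w_2)=K(g(\hbar)w_1,w_2)=K(w_1,g^*(\hbar)w_2)$ for $g(\hbar)\in\mathbb{C}(\!(\hbar)\!)$; (H3) $\partial_\alpha K(w_1,w_2)=K(\nabla_\alpha w_1,w_2)+K(w_1,\nabla_\alpha w_2)$ for all $\alpha\in I$; (H4) $\partial_{\hbar^{-1}}K(w_1,w_2)=K(\nabla_{\hbar^{-1}}w_1,w_2)-K(w_1,\nabla_{\hbar^{-1}}w_2)$; (H5) for $w_1,w_2\in T_{\mathbb{H}}[\![\hbar]\!]$, $K(w_1,w_2)\in\mathbb{C}[\![\underline t]\!][\![\hbar]\!]$ and $K(w_1,w_2)|_{\hbar=0}=\eta(w_1|_{\hbar=0},w_2|_{\hbar=0})$. *)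

theory Defs
  imports "HOL-Homology.Homology" "HOL-Computational_Algebra.Computational_Algebra"
begin

section \<open>Formal power series in the variables \<open>t\<^sup>\<alpha>\<close>\<close>

text \<open>
  An element of \<open>('i, 'a) mps\<close> is a formal power series in commuting variables indexed by
  \<open>'i\<close>, given by its coefficient at every monomial. Laurent series in \<open>\<hbar>\<close> with coefficients
  in such series form the type \<open>('i, 'a) mps fls\<close>, with \<open>fls_X\<close> in the role of \<open>\<hbar>\<close>.
\<close>

typedef ('i, 'a) mps = "UNIV :: (('i \<Rightarrow>\<^sub>0 nat) \<Rightarrow> 'a) set"
  morphisms mps_nth Abs_mps ..

lemma mps_nth_Abs_mps [simp]: "mps_nth (Abs_mps f) = f"
  by (simp add: Abs_mps_inverse)

lemma mps_eqI: "(\<And>m. mps_nth f m = mps_nth g m) \<Longrightarrow> f = g"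
  by (metis ext mps_nth_inject)

instantiation mps :: (type, zero) zero
begin
definition zero_mps_def: "0 = Abs_mps (\<lambda>_. 0)"
instance ..
end

instantiation mps :: (type, "{zero, one}") one
begin
definition one_mps_def: "1 = Abs_mps (\<lambda>m. if m = 0 then 1 else 0)"
instance ..
end

instantiation mps :: (type, plus) plus
begin
definition plus_mps_def: "f + g = Abs_mps (\<lambda>m. mps_nth f m + mps_nth g m)"
instance ..
end

instantiation mps :: (type, minus) minus
begin
definition minus_mps_def: "f - g = Abs_mps (\<lambda>m. mps_nth f m - mps_nth g m)"
instance ..
end

instantiation mps :: (type, uminus) uminus
begin
definition uminus_mps_def: "- f = Abs_mps (\<lambda>m. - mps_nth f m)"
instance ..
end

definition splittings :: "('i \<Rightarrow>\<^sub>0 nat) \<Rightarrow> (('i \<Rightarrow>\<^sub>0 nat) \<times> ('i \<Rightarrow>\<^sub>0 nat)) set" where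
  "splittings m = {(a, b). a + b = m}"

instantiation mps :: (type, "{comm_monoid_add, times}") times
begin
definition times_mps_def:
  "f * g = Abs_mps (\<lambda>m. \<Sum>(a, b)\<in>splittings m. mps_nth f a * mps_nth g b)"
instance ..
end

lemma mps_nth_zero [simp]: "mps_nth 0 m = 0"
  and mps_nth_one: "mps_nth 1 m = (if m = 0 then 1 else 0)"
  and mps_nth_plus [simp]: "mps_nth (f + g) m = mps_nth f m + mps_nth g m"
  and mps_nth_minus [simp]: "mps_nth (f' - g') m = mps_nth f' m - mps_nth g' m"
  and mps_nth_uminus [simp]: "mps_nth (- h) m = - mps_nth h m"
  by (simp_all add: zero_mps_def one_mps_def plus_mps_def minus_mps_def uminus_mps_def)

lemma mps_nth_times:
  "mps_nth (f * g) m = (\<Sum>(a, b)\<in>splittings m. mps_nth f a * mps_nth g b)"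
  by (simp add: times_mps_def)

lemma finite_splittings [simp]: "finite (splittings m)"
proof -
  let ?K = "Poly_Mapping.keys m"
  let ?F = "{h. \<forall>i. (i \<in> ?K \<longrightarrow> h i \<in> {..Max (Poly_Mapping.lookup m ` ?K)}) \<and> (i \<notin> ?K \<longrightarrow> h i = (0::nat))}"
  have fin: "finite ?F"
    by (rule finite_set_of_finite_funs) auto
  have sub: "Poly_Mapping.lookup a \<in> ?F" if "a + b = m" for a b
  proof -
    have le: "Poly_Mapping.lookup a i \<le> Poly_Mapping.lookup m i" for i
      using that by (auto simp: lookup_add)
    have "Poly_Mapping.lookup a i \<le> Max (Poly_Mapping.lookup m ` ?K)" if "i \<in> ?K" for i
      using le[of i] that by (meson Max_ge finite_imageI finite_keys imageI order_trans)
    moreover have "Poly_Mapping.lookup a i = 0" if "i \<notin> ?K" for i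
      using le[of i] that by (simp add: in_keys_iff)
    ultimately show ?thesis by auto
  qed
  have fa: "finite {a. Poly_Mapping.lookup a \<in> ?F}"
    using finite_vimageI[OF fin, of Poly_Mapping.lookup]
    by (auto simp: vimage_def inj_on_def lookup_inject)
  have "splittings m \<subseteq> (\<lambda>a. (a, m - a)) ` {a. Poly_Mapping.lookup a \<in> ?F}"
    using sub by (force simp: splittings_def)
  then show ?thesis using fa finite_surj by blast
qed

lemma splittings_swap:
  "(\<Sum>(a, b)\<in>splittings m. h a b) = (\<Sum>(a, b)\<in>splittings m. h b a)"
  by (rule sum.reindex_bij_witness[where i = prod.swap and j = prod.swap])
     (auto simp: splittings_def add.commute)

lemma splittings_assoc:
  fixes h :: "_ \<Rightarrow> _ \<Rightarrow> _ \<Rightarrow> 'a::comm_monoid_add"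
  shows "(\<Sum>(p, c)\<in>splittings m. \<Sum>(a, b)\<in>splittings p. h a b c)
       = (\<Sum>(a, q)\<in>splittings m. \<Sum>(b, c)\<in>splittings q. h a b c)"
proof -
  have "(\<Sum>(p, c)\<in>splittings m. \<Sum>(a, b)\<in>splittings p. h a b c)
      = (\<Sum>((p, c), (a, b))\<in>(SIGMA x:splittings m. splittings (fst x)). h a b c)"
    by (subst sum.Sigma[symmetric]) (auto simp: case_prod_unfold)
  also have "\<dots> = (\<Sum>((a, q), (b, c))\<in>(SIGMA x:splittings m. splittings (snd x)). h a b c)"
    by (rule sum.reindex_bij_witness[where
          i = "\<lambda>((a, q), (b, c)). ((a + b, c), (a, b))" and
          j = "\<lambda>((p, c), (a, b)). ((a, b + c), (b, c))"])
       (auto simp: splittings_def add.assoc)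
  also have "\<dots> = (\<Sum>(a, q)\<in>splittings m. \<Sum>(b, c)\<in>splittings q. h a b c)"
    by (subst sum.Sigma[symmetric]) (auto simp: case_prod_unfold)
  finally show ?thesis .
qed

instance mps :: (type, monoid_add) monoid_add
  by standard (auto intro!: mps_eqI simp: add.assoc)

instance mps :: (type, comm_monoid_add) comm_monoid_add
  by standard (auto intro!: mps_eqI simp: add.commute)

instance mps :: (type, group_add) group_add
  by standard (auto intro!: mps_eqI)

instance mps :: (type, ab_group_add) ab_group_add
  by standard (auto intro!: mps_eqI)

lemma mps_one_mult:
  fixes f :: "('i, 'a::comm_ring_1) mps"
  shows "1 * f = f"
proof (rule mps_eqI)
  fix m
  have "mps_nth (1 * f) m = (\<Sum>(a, b)\<in>{(0, m)}. mps_nth (1 :: ('i, 'a) mps) a * mps_nth f b)"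
    unfolding mps_nth_times
    by (rule sum.mono_neutral_right) (use finite_splittings in \<open>auto simp: splittings_def mps_nth_one split: if_splits\<close>)
  then show "mps_nth (1 * f) m = mps_nth f m" by (simp add: mps_nth_one)
qed

instance mps :: (type, comm_ring_1) comm_ring_1
proof
  fix f g h :: "('a, 'b) mps"
  show "f * g * h = f * (g * h)"
  proof (rule mps_eqI)
    fix m
    have "mps_nth (f * g * h) m
        = (\<Sum>(p, c)\<in>splittings m. \<Sum>(a, b)\<in>splittings p. mps_nth f a * mps_nth g b * mps_nth h c)"
      by (simp add: mps_nth_times sum_distrib_right case_prod_unfold)
    also have "\<dots> = (\<Sum>(a, q)\<in>splittings m. \<Sum>(b, c)\<in>splittings q. mps_nth f a * mps_nth g b * mps_nth h c)"
      by (rule splittings_assoc)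
    also have "\<dots> = mps_nth (f * (g * h)) m"
      by (simp add: mps_nth_times sum_distrib_left case_prod_unfold mult.assoc)
    finally show "mps_nth (f * g * h) m = mps_nth (f * (g * h)) m" .
  qed
  show "f * g = g * f"
    by (rule mps_eqI, unfold mps_nth_times, subst splittings_swap) (simp add: mult.commute)
  show "1 * f = f" by (rule mps_one_mult)
  show "(f + g) * h = f * h + g * h"
    by (rule mps_eqI) (simp add: mps_nth_times distrib_right sum.distrib case_prod_unfold)
  have "mps_nth (0 :: ('a, 'b) mps) 0 \<noteq> mps_nth 1 0" by (simp add: mps_nth_one)
  then show "(0 :: ('a, 'b) mps) \<noteq> 1" by metis
qed

definition mps_const :: "'a::zero \<Rightarrow> ('i, 'a) mps" where
  "mps_const c = Abs_mps (\<lambda>m. if m = 0 then c else 0)"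

definition mps_var :: "'i \<Rightarrow> ('i, 'a::{zero, one}) mps" where
  "mps_var \<alpha> = Abs_mps (\<lambda>m. if m = Poly_Mapping.single \<alpha> 1 then 1 else 0)"

definition mps_deriv :: "'i \<Rightarrow> ('i, 'a::semiring_1) mps \<Rightarrow> ('i, 'a) mps" where
  "mps_deriv \<alpha> f =
     Abs_mps (\<lambda>m. of_nat (Poly_Mapping.lookup m \<alpha> + 1) * mps_nth f (m + Poly_Mapping.single \<alpha> 1))"

definition mps_map :: "('a \<Rightarrow> 'b) \<Rightarrow> ('i, 'a) mps \<Rightarrow> ('i, 'b) mps" where
  "mps_map f F = Abs_mps (\<lambda>m. f (mps_nth F m))"

text \<open>In \<open>fls_map f\<close> and \<open>series_map f\<close> it is understood that \<open>f 0 = 0\<close>.\<close>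

definition fls_map :: "('a::zero \<Rightarrow> 'b::zero) \<Rightarrow> 'a fls \<Rightarrow> 'b fls" where
  "fls_map f F = Abs_fls (\<lambda>j. f (fls_nth F j))"

definition series_map :: "('a::zero \<Rightarrow> 'b::zero) \<Rightarrow> ('i, 'a) mps fls \<Rightarrow> ('i, 'b) mps fls" where
  "series_map f = fls_map (mps_map f)"

definition power_over :: "'a set \<Rightarrow> ('i, 'a) mps set" where
  "power_over B = {F. \<forall>m. mps_nth F m \<in> B}"

definition laurent_over :: "'a::zero set \<Rightarrow> ('i, 'a) mps fls set" where
  "laurent_over B = {F. \<forall>j. fls_nth F j \<in> power_over B}"

definition hbar_flip :: "'a::group_add fls \<Rightarrow> 'a fls" where
  "hbar_flip F = Abs_fls (\<lambda>j. if even j then fls_nth F j else - fls_nth F j)"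

text \<open>\<open>\<partial>/\<partial>\<hbar>\<^sup>-\<^sup>1 = - \<hbar>\<^sup>2 \<partial>/\<partial>\<hbar>\<close>\<close>

definition hbar_inv_deriv :: "'a::comm_ring_1 fls \<Rightarrow> 'a fls" where
  "hbar_inv_deriv F = - (fls_X ^ 2 * fls_deriv F)"

text \<open>
  For a complex vector space \<open>H\<close> with scalar multiplication \<open>sc\<close>, the space \<open>H[[t]]((\<hbar>))\<close> is a
  module over \<open>\<complex>[[t]]((\<hbar>))\<close>.
\<close>

definition mps_scale ::
  "(complex \<Rightarrow> 'h::ab_group_add \<Rightarrow> 'h) \<Rightarrow> ('i, complex) mps \<Rightarrow> ('i, 'h) mps \<Rightarrow> ('i, 'h) mps" where
  "mps_scale sc c w = Abs_mps (\<lambda>m. \<Sum>(a, b)\<in>splittings m. sc (mps_nth c a) (mps_nth w b))"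

definition laurent_scale ::
  "(complex \<Rightarrow> 'h::ab_group_add \<Rightarrow> 'h) \<Rightarrow> ('i, complex) mps fls \<Rightarrow> ('i, 'h) mps fls \<Rightarrow> ('i, 'h) mps fls" where
  "laurent_scale sc c w = Abs_fls (\<lambda>j.
     \<Sum>i = fls_subdegree c..j - fls_subdegree w. mps_scale sc (fls_nth c i) (fls_nth w (j - i)))"


section \<open>Polynomials, complete intersections and primitive cohomology\<close>

text \<open>
  The homogeneous coordinates \<open>x\<^sub>0, \<dots>, x\<^sub>n\<close> are indexed by a finite type \<open>'n\<close> with \<open>n + 1\<close> elements,
  the variables \<open>y\<^sub>1, \<dots>, y\<^sub>k\<close> by a finite type \<open>'k\<close> with \<open>k\<close> elements, and the joint variables
  \<open>q\<^sub>1, \<dots>, q\<^sub>N\<close> by \<open>'k + 'n\<close>.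
\<close>

type_synonym 'v cpoly = "('v \<Rightarrow>\<^sub>0 nat) \<Rightarrow>\<^sub>0 complex"

definition peval :: "'v::finite cpoly \<Rightarrow> complex ^ 'v \<Rightarrow> complex" where
  "peval p x = (\<Sum>m\<in>Poly_Mapping.keys p.
     Poly_Mapping.lookup p m * (\<Prod>i\<in>UNIV. (x $ i) ^ Poly_Mapping.lookup m i))"

text \<open>If \<open>i\<close> does not occur in \<open>m\<close>, the truncated difference below is harmless: its coefficient is 0.\<close>

definition pdiff :: "'v \<Rightarrow> 'v cpoly \<Rightarrow> 'v cpoly" where
  "pdiff i p = (\<Sum>m\<in>Poly_Mapping.keys p.
     Poly_Mapping.single (m - Poly_Mapping.single i 1)
       (of_nat (Poly_Mapping.lookup m i) * Poly_Mapping.lookup p m))"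

definition cmul :: "complex \<Rightarrow> 'v cpoly \<Rightarrow> 'v cpoly" where
  "cmul c p = Poly_Mapping.single 0 c * p"

definition homogeneous_poly :: "nat \<Rightarrow> 'n::finite cpoly \<Rightarrow> bool" where
  "homogeneous_poly e p \<longleftrightarrow>
     (\<forall>m\<in>Poly_Mapping.keys p. (\<Sum>j\<in>UNIV. Poly_Mapping.lookup m j) = e)"

definition common_zeros :: "('k \<Rightarrow> 'n::finite cpoly) \<Rightarrow> (complex ^ 'n) set" where
  "common_zeros G = {x. x \<noteq> 0 \<and> (\<forall>l. peval (G l) x = 0)}"

text \<open>
  Jacobian criterion: the \<open>G\<^sub>l\<close> define a nonempty subscheme of projective space that is smooth
  of codimension \<open>k\<close>.
\<close>

definition smooth_complete_intersection :: "('k::finite \<Rightarrow> 'n::finite cpoly) \<Rightarrow> bool" where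
  "smooth_complete_intersection G \<longleftrightarrow>
     common_zeros G \<noteq> {} \<and>
     (\<forall>x\<in>common_zeros G. \<forall>c :: 'k \<Rightarrow> complex.
        (\<forall>j. (\<Sum>l\<in>UNIV. c l * peval (pdiff j (G l)) x) = 0) \<longrightarrow> (\<forall>l. c l = 0))"

definition proj_point :: "complex ^ 'n::finite \<Rightarrow> (complex ^ 'n) set" where
  "proj_point x = {c *s x | c. c \<noteq> 0}"

text \<open>Complex projective space with the (analytic) quotient topology.\<close>

definition projective_space :: "(complex ^ 'n::finite) set topology" where
  "projective_space = topology (\<lambda>U. U \<subseteq> proj_point ` (- {0}) \<and> open {x. x \<noteq> 0 \<and> proj_point x \<in> U})"

lemma openin_projective_space:
  fixes U :: "(complex ^ 'n::finite) set set"
  shows "openin projective_space U \<longleftrightarrow>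
     U \<subseteq> proj_point ` (- {0}) \<and> open {x. x \<noteq> 0 \<and> proj_point x \<in> U}"
proof -
  let ?L = "\<lambda>U :: (complex ^ 'n) set set.
    U \<subseteq> proj_point ` (- {0}) \<and> open {x. x \<noteq> 0 \<and> proj_point x \<in> U}"
  have "?L (S \<inter> T)" if "?L S" "?L T" for S T
  proof -
    have "open ({x. x \<noteq> 0 \<and> proj_point x \<in> S} \<inter> {x. x \<noteq> 0 \<and> proj_point x \<in> T})"
      using that by (intro open_Int) auto
    moreover have "{x. x \<noteq> 0 \<and> proj_point x \<in> S} \<inter> {x. x \<noteq> 0 \<and> proj_point x \<in> T}
        = {x. x \<noteq> 0 \<and> proj_point x \<in> S \<inter> T}" by auto
    ultimately show ?thesis using that by auto
  qed
  moreover have "?L (\<Union>\<K>)" if "\<forall>U\<in>\<K>. ?L U" for \<K>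
  proof -
    have "open (\<Union>U\<in>\<K>. {x. x \<noteq> 0 \<and> proj_point x \<in> U})" using that by blast
    moreover have "(\<Union>U\<in>\<K>. {x. x \<noteq> 0 \<and> proj_point x \<in> U})
        = {x. x \<noteq> 0 \<and> proj_point x \<in> \<Union>\<K>}" by auto
    ultimately show ?thesis using that by auto
  qed
  ultimately have "istopology ?L" unfolding istopology_def by blast
  then show ?thesis unfolding projective_space_def by (simp only: topology_inverse')
qed

definition variety :: "('k \<Rightarrow> 'n::finite cpoly) \<Rightarrow> (complex ^ 'n) set topology" where
  "variety G = subtopology projective_space (proj_point ` common_zeros G)"

text \<open>
  Singular cohomology with complex coefficients. A cochain is a function on singular simplices,
  normalised to vanish off the simplices of the given dimension and space.
\<close>

type_synonym 'a cochain = "((nat \<Rightarrow> real) \<Rightarrow> 'a) \<Rightarrow> complex"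

definition cochains :: "nat \<Rightarrow> 'a topology \<Rightarrow> 'a cochain set" where
  "cochains p X = {\<phi>. \<forall>\<sigma>. \<not> singular_simplex p X \<sigma> \<longrightarrow> \<phi> \<sigma> = 0}"

definition coboundary :: "nat \<Rightarrow> 'a topology \<Rightarrow> 'a cochain \<Rightarrow> 'a cochain" where
  "coboundary p X \<phi> = (\<lambda>\<sigma>. if singular_simplex (Suc p) X \<sigma>
     then \<Sum>k\<le>Suc p. (- 1) ^ k * \<phi> (singular_face (Suc p) k \<sigma>) else 0)"

definition cocycles :: "nat \<Rightarrow> 'a topology \<Rightarrow> 'a cochain set" where
  "cocycles p X = {\<phi> \<in> cochains p X. coboundary p X \<phi> = (\<lambda>_. 0)}"

definition coboundaries :: "nat \<Rightarrow> 'a topology \<Rightarrow> 'a cochain set" where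
  "coboundaries p X = (case p of 0 \<Rightarrow> {\<lambda>_. 0} | Suc r \<Rightarrow> coboundary r X ` cochains r X)"

definition front_face :: "nat \<Rightarrow> ((nat \<Rightarrow> real) \<Rightarrow> 'a) \<Rightarrow> ((nat \<Rightarrow> real) \<Rightarrow> 'a)" where
  "front_face p \<sigma> = restrict \<sigma> (standard_simplex p)"

definition back_face :: "nat \<Rightarrow> nat \<Rightarrow> ((nat \<Rightarrow> real) \<Rightarrow> 'a) \<Rightarrow> ((nat \<Rightarrow> real) \<Rightarrow> 'a)" where
  "back_face p q \<sigma> =
     restrict (\<lambda>x. \<sigma> (\<lambda>i. if i < p then 0 else x (i - p))) (standard_simplex q)"

definition cup_product ::
  "nat \<Rightarrow> nat \<Rightarrow> 'a topology \<Rightarrow> 'a cochain \<Rightarrow> 'a cochain \<Rightarrow> 'a cochain" where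
  "cup_product p q X \<phi> \<psi> = (\<lambda>\<sigma>. if singular_simplex (p + q) X \<sigma>
     then \<phi> (front_face p \<sigma>) * \<psi> (back_face p q \<sigma>) else 0)"

text \<open>
  Cocycles representing the primitive classes in the middle cohomology of \<open>X\<close>, where \<open>m\<close> is the
  dimension of \<open>X\<close>. For \<open>m > 0\<close> these are the classes killed by cup product with the hyperplane
  class; as \<open>H\<^sup>2\<close> of projective space is spanned by that class, this is the same as being killed by
  (the restriction of) every class of \<open>H\<^sup>2\<close>. For \<open>m = 0\<close> that condition is void, and the primitive
  part of \<open>H\<^sup>0\<close> of the finite set \<open>X\<close> is, as usual, the part of total degree zero.
\<close>

definition primitive_cocycles ::
  "nat \<Rightarrow> ('k \<Rightarrow> 'n::finite cpoly) \<Rightarrow> (complex ^ 'n) set cochain set" where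
  "primitive_cocycles m G = {\<phi> \<in> cocycles m (variety G).
     if m = 0 then (\<Sum>P\<in>topspace (variety G). \<phi> (restrict (\<lambda>_. P) (standard_simplex 0))) = 0
     else \<forall>\<psi>\<in>cocycles 2 projective_space.
            cup_product m 2 (variety G) \<phi> \<psi> \<in> coboundaries (m + 2) (variety G)}"

text \<open>
  The complex vector space \<open>'h\<close> is the primitive cohomology, i.e. the quotient of the primitive
  cocycles by the coboundaries; \<open>\<kappa>\<close> sends a primitive cocycle to its class.
\<close>

definition is_primitive_cohomology ::
  "nat \<Rightarrow> ('k \<Rightarrow> 'n::finite cpoly) \<Rightarrow> (complex \<Rightarrow> 'h::ab_group_add \<Rightarrow> 'h) \<Rightarrow> bool" where
  "is_primitive_cohomology m G sc \<longleftrightarrow>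
     vector_space sc \<and>
     (\<exists>\<kappa> :: (complex ^ 'n) set cochain \<Rightarrow> 'h.
        (\<forall>\<phi>\<in>primitive_cocycles m G. \<forall>\<psi>\<in>primitive_cocycles m G. \<forall>a.
           \<kappa> (\<lambda>\<sigma>. a * \<phi> \<sigma> + \<psi> \<sigma>) = sc a (\<kappa> \<phi>) + \<kappa> \<psi>) \<and>
        (\<forall>\<phi>\<in>primitive_cocycles m G. \<kappa> \<phi> = 0 \<longleftrightarrow> \<phi> \<in> coboundaries m (variety G)) \<and>
        \<kappa> ` primitive_cocycles m G = UNIV)"


section \<open>The super-commutative algebra \<open>\<A>\<close> and the operator \<open>Q\<^sub>S\<close>\<close>

text \<open>
  \<open>\<A>\<close> is free over \<open>\<complex>[q]\<close> on the monomials \<open>\<eta>\<^sub>T = \<eta>\<^bsub>i\<^sub>1\<^esub> \<cdots> \<eta>\<^bsub>i\<^sub>r\<^esub>\<close> with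
  \<open>T = {i\<^sub>1 < \<dots> < i\<^sub>r}\<close>, the variables being ordered as \<open>y\<^sub>1, \<dots>, y\<^sub>k, x\<^sub>0, \<dots>, x\<^sub>n\<close>. Its degree 0
  part consists of the multiples of \<open>\<eta>\<^bsub>{}\<^esub> = 1\<close> and is identified with \<open>\<complex>[q]\<close>, which is the only part
  in which products are needed.
\<close>

type_synonym ('k, 'n) bv = "('k + 'n) set \<Rightarrow>\<^sub>0 ('k + 'n) cpoly"

fun var_less :: "'k::linorder + 'n::linorder \<Rightarrow> 'k + 'n \<Rightarrow> bool" where
  "var_less (Inl a) (Inl b) = (a < b)"
| "var_less (Inl a) (Inr j) = True"
| "var_less (Inr i) (Inl b) = False"
| "var_less (Inr i) (Inr j) = (i < j)"

definition eta_diff ::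
  "'k::{finite,linorder} + 'n::{finite,linorder} \<Rightarrow> ('k, 'n) bv \<Rightarrow> ('k, 'n) bv" where
  "eta_diff i a = Poly_Mapping.Abs_poly_mapping (\<lambda>T. if i \<in> T then 0
     else (- 1) ^ card {j \<in> T. var_less j i} * Poly_Mapping.lookup a (insert i T))"

lemma lookup_eta_diff:
  "Poly_Mapping.lookup (eta_diff i a) T = (if i \<in> T then 0
     else (- 1) ^ card {j \<in> T. var_less j i} * Poly_Mapping.lookup a (insert i T))"
  unfolding eta_diff_def by (subst Abs_poly_mapping_inverse) auto

definition embed_x :: "'n::finite cpoly \<Rightarrow> ('k + 'n) cpoly" where
  "embed_x p = (\<Sum>m\<in>Poly_Mapping.keys p.
     Poly_Mapping.single (\<Sum>j\<in>UNIV. Poly_Mapping.single (Inr j) (Poly_Mapping.lookup m j))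
       (Poly_Mapping.lookup p m))"

definition action_S :: "('k::finite \<Rightarrow> 'n::finite cpoly) \<Rightarrow> ('k + 'n) cpoly" where
  "action_S G = (\<Sum>l\<in>UNIV. Poly_Mapping.single (Poly_Mapping.single (Inl l) 1) 1 * embed_x (G l))"

definition Q_S ::
  "('k::{finite,linorder} \<Rightarrow> 'n::{finite,linorder} cpoly) \<Rightarrow> ('k, 'n) bv \<Rightarrow> ('k, 'n) bv" where
  "Q_S G a = (\<Sum>i\<in>UNIV. Poly_Mapping.map ((*) (pdiff i (action_S G))) (eta_diff i a))"

definition bv_of_poly :: "('k + 'n) cpoly \<Rightarrow> ('k, 'n) bv" where
  "bv_of_poly p = Poly_Mapping.single {} p"

text \<open>
  \<open>graded_piece g h c\<close>: the part of degree \<open>c\<close> for the grading giving \<open>q\<^sub>i\<close> degree \<open>g i\<close> and \<open>\<eta>\<^sub>i\<close>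
  degree \<open>h i\<close>.
\<close>

definition graded_piece ::
  "('k::finite + 'n::finite \<Rightarrow> int) \<Rightarrow> ('k + 'n \<Rightarrow> int) \<Rightarrow> int \<Rightarrow> ('k, 'n) bv set" where
  "graded_piece g h c = {a. \<forall>T\<in>Poly_Mapping.keys a. \<forall>m\<in>Poly_Mapping.keys (Poly_Mapping.lookup a T).
     (\<Sum>i\<in>UNIV. int (Poly_Mapping.lookup m i) * g i) + (\<Sum>i\<in>T. h i) = c}"

definition var_charge :: "('k \<Rightarrow> nat) \<Rightarrow> 'k + 'n \<Rightarrow> int" where
  "var_charge d q = (case q of Inl l \<Rightarrow> - int (d l) | Inr j \<Rightarrow> 1)"

definition var_weight :: "'k + 'n \<Rightarrow> int" where
  "var_weight q = (case q of Inl l \<Rightarrow> 1 | Inr j \<Rightarrow> 0)"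

definition weight_piece :: "int \<Rightarrow> ('k::finite, 'n::finite) bv set" where
  "weight_piece = graded_piece var_weight (\<lambda>i. 1 - var_weight i)"

definition A0 :: "('k::finite \<Rightarrow> nat) \<Rightarrow> int \<Rightarrow> ('k, 'n::finite) bv set" where
  "A0 d j = graded_piece (\<lambda>_. 0) (\<lambda>_. - 1) j \<inter>
            graded_piece (var_charge d) (\<lambda>i. - var_charge d i) 0"

definition A00 :: "('k::finite \<Rightarrow> nat) \<Rightarrow> ('k + 'n::finite) cpoly set" where
  "A00 d = {p. bv_of_poly p \<in> A0 d 0}"

text \<open>On \<open>\<A>\<^sup>-\<^sup>1\<close> the operator \<open>Q\<^sub>S\<close> takes values in \<open>\<A>\<^sup>0 = \<complex>[q]\<close>.\<close>

definition Q_S_poly ::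
  "('k::{finite,linorder} \<Rightarrow> 'n::{finite,linorder} cpoly) \<Rightarrow> ('k, 'n) bv \<Rightarrow> ('k + 'n) cpoly" where
  "Q_S_poly G a = Poly_Mapping.lookup (Q_S G a) {}"

definition exact ::
  "('k::{finite,linorder} \<Rightarrow> nat) \<Rightarrow> ('k \<Rightarrow> 'n::{finite,linorder} cpoly) \<Rightarrow> ('k + 'n) cpoly set" where
  "exact d G = Q_S_poly G ` A0 d (- 1)"

definition jclass ::
  "('k::{finite,linorder} \<Rightarrow> nat) \<Rightarrow> ('k \<Rightarrow> 'n::{finite,linorder} cpoly)
     \<Rightarrow> ('k + 'n) cpoly \<Rightarrow> ('k + 'n) cpoly set" where
  "jclass d G p = {p' \<in> A00 d. p' - p \<in> exact d G}"

text \<open>\<open>\<Phi>\<close> is a complex linear isomorphism from \<open>\<A>\<^sub>0\<^sup>0 / Q\<^sub>S(\<A>\<^sub>0\<^sup>-\<^sup>1)\<close>, a set of cosets, onto \<open>'h\<close>.\<close>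

definition jacobian_iso ::
  "('k::{finite,linorder} \<Rightarrow> nat) \<Rightarrow> ('k \<Rightarrow> 'n::{finite,linorder} cpoly)
     \<Rightarrow> (complex \<Rightarrow> 'h::ab_group_add \<Rightarrow> 'h) \<Rightarrow> (('k + 'n) cpoly set \<Rightarrow> 'h) \<Rightarrow> bool" where
  "jacobian_iso d G sc \<Phi> \<longleftrightarrow>
     bij_betw \<Phi> (jclass d G ` A00 d) UNIV \<and>
     (\<forall>p\<in>A00 d. \<forall>p'\<in>A00 d. \<forall>a.
        \<Phi> (jclass d G (cmul a p + p')) = sc a (\<Phi> (jclass d G p)) + \<Phi> (jclass d G p'))"

definition jacobian_basis ::
  "('k::{finite,linorder} \<Rightarrow> nat) \<Rightarrow> ('k \<Rightarrow> 'n::{finite,linorder} cpoly)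
     \<Rightarrow> ('i::finite \<Rightarrow> ('k + 'n) cpoly) \<Rightarrow> bool" where
  "jacobian_basis d G u \<longleftrightarrow>
     (\<forall>\<alpha>. u \<alpha> \<in> A00 d) \<and>
     (\<forall>p\<in>A00 d. \<exists>!c :: 'i \<Rightarrow> complex. jclass d G p = jclass d G (\<Sum>\<alpha>\<in>UNIV. cmul (c \<alpha>) (u \<alpha>)))"

text \<open>The extensions of \<open>\<Phi>\<close> to \<open>\<A>\<^sub>0\<^sup>0[[t]]\<close> and to \<open>\<A>\<^sub>0\<^sup>0[[t]]((\<hbar>))\<close>.\<close>

definition Phi_power ::
  "('k::{finite,linorder} \<Rightarrow> nat) \<Rightarrow> ('k \<Rightarrow> 'n::{finite,linorder} cpoly)
     \<Rightarrow> (('k + 'n) cpoly set \<Rightarrow> 'h::ab_group_add)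
     \<Rightarrow> ('i, ('k + 'n) cpoly) mps \<Rightarrow> ('i, 'h) mps" where
  "Phi_power d G \<Phi> = mps_map (\<lambda>p. \<Phi> (jclass d G p))"

definition Phi_laurent ::
  "('k::{finite,linorder} \<Rightarrow> nat) \<Rightarrow> ('k \<Rightarrow> 'n::{finite,linorder} cpoly)
     \<Rightarrow> (('k + 'n) cpoly set \<Rightarrow> 'h::ab_group_add)
     \<Rightarrow> ('i, ('k + 'n) cpoly) mps fls \<Rightarrow> ('i, 'h) mps fls" where
  "Phi_laurent d G \<Phi> = series_map (\<lambda>p. \<Phi> (jclass d G p))"


section \<open>Connections, pairings, modified higher residue pairings\<close>

definition def_L :: "('i::finite \<Rightarrow> ('k + 'n) cpoly) \<Rightarrow> ('i, ('k + 'n) cpoly) mps" where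
  "def_L u = (\<Sum>\<alpha>\<in>UNIV. mps_var \<alpha> * mps_const (u \<alpha>))"

text \<open>
  The connections on \<open>T\<^sub>H((\<hbar>)) = J\<close>, computed on an arbitrary representative \<open>v\<close> of \<open>w\<close>. They are
  independent of the representative, which is what makes the definite descriptions meaningful here
  and in the two pairings below.
\<close>

definition nabla ::
  "('k::{finite,linorder} \<Rightarrow> nat) \<Rightarrow> ('k \<Rightarrow> 'n::{finite,linorder} cpoly)
     \<Rightarrow> ('i::finite \<Rightarrow> ('k + 'n) cpoly) \<Rightarrow> (('k + 'n) cpoly set \<Rightarrow> 'h::ab_group_add)
     \<Rightarrow> 'i \<Rightarrow> ('i, 'h) mps fls \<Rightarrow> ('i, 'h) mps fls" where
  "nabla d G u \<Phi> \<alpha> w = (THE w'. \<exists>v\<in>laurent_over (A00 d).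
     w = Phi_laurent d G \<Phi> v \<and>
     w' = Phi_laurent d G \<Phi>
            (fls_map (mps_deriv \<alpha>) v + fls_X_inv * fls_const (mps_const (u \<alpha>)) * v))"

definition nabla_hbar_inv ::
  "('k::{finite,linorder} \<Rightarrow> nat) \<Rightarrow> ('k \<Rightarrow> 'n::{finite,linorder} cpoly)
     \<Rightarrow> ('i::finite \<Rightarrow> ('k + 'n) cpoly) \<Rightarrow> (('k + 'n) cpoly set \<Rightarrow> 'h::ab_group_add)
     \<Rightarrow> ('i, 'h) mps fls \<Rightarrow> ('i, 'h) mps fls" where
  "nabla_hbar_inv d G u \<Phi> w = (THE w'. \<exists>v\<in>laurent_over (A00 d).
     w = Phi_laurent d G \<Phi> v \<and>
     w' = Phi_laurent d G \<Phi>
            (hbar_inv_deriv v + fls_const (mps_const (action_S G) + def_L u) * v))"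

definition expands_power ::
  "('k::{finite,linorder} \<Rightarrow> nat) \<Rightarrow> ('k \<Rightarrow> 'n::{finite,linorder} cpoly)
     \<Rightarrow> ('i::finite \<Rightarrow> ('k + 'n) cpoly) \<Rightarrow> ('i, ('k + 'n) cpoly) mps
     \<Rightarrow> ('i \<Rightarrow> ('i, complex) mps) \<Rightarrow> bool" where
  "expands_power d G u v A \<longleftrightarrow> (\<exists>\<Lambda>\<in>power_over (A0 d (- 1)).
     v = (\<Sum>\<rho>\<in>UNIV. mps_map (\<lambda>c. cmul c (u \<rho>)) (A \<rho>)) + mps_map (Q_S_poly G) \<Lambda>)"

definition expands_laurent ::
  "('k::{finite,linorder} \<Rightarrow> nat) \<Rightarrow> ('k \<Rightarrow> 'n::{finite,linorder} cpoly)
     \<Rightarrow> ('i::finite \<Rightarrow> ('k + 'n) cpoly) \<Rightarrow> ('i, ('k + 'n) cpoly) mps fls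
     \<Rightarrow> ('i \<Rightarrow> ('i, complex) mps fls) \<Rightarrow> bool" where
  "expands_laurent d G u v A \<longleftrightarrow> (\<exists>\<Lambda>\<in>laurent_over (A0 d (- 1)).
     v = (\<Sum>\<rho>\<in>UNIV. series_map (\<lambda>c. cmul c (u \<rho>)) (A \<rho>)) + series_map (Q_S_poly G) \<Lambda>)"

definition eta_pairing ::
  "('k::{finite,linorder} \<Rightarrow> nat) \<Rightarrow> ('k \<Rightarrow> 'n::{finite,linorder} cpoly)
     \<Rightarrow> ('i::finite \<Rightarrow> ('k + 'n) cpoly) \<Rightarrow> 'i \<Rightarrow> (('k + 'n) cpoly set \<Rightarrow> 'h::ab_group_add)
     \<Rightarrow> ('i, 'h) mps \<Rightarrow> ('i, 'h) mps \<Rightarrow> ('i, complex) mps" where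
  "eta_pairing d G u mx \<Phi> w1 w2 =
     (THE c. \<exists>v1\<in>power_over (A00 d). \<exists>v2\<in>power_over (A00 d). \<exists>A.
        w1 = Phi_power d G \<Phi> v1 \<and> w2 = Phi_power d G \<Phi> v2 \<and>
        expands_power d G u (v1 * v2) A \<and> c = A mx)"

definition residue_pairing ::
  "('k::{finite,linorder} \<Rightarrow> nat) \<Rightarrow> ('k \<Rightarrow> 'n::{finite,linorder} cpoly)
     \<Rightarrow> ('i::finite \<Rightarrow> ('k + 'n) cpoly) \<Rightarrow> 'i \<Rightarrow> (('k + 'n) cpoly set \<Rightarrow> 'h::ab_group_add)
     \<Rightarrow> ('i, 'h) mps fls \<Rightarrow> ('i, 'h) mps fls \<Rightarrow> ('i, complex) mps fls" where
  "residue_pairing d G u mx \<Phi> w1 w2 =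
     (THE c. \<exists>v1\<in>laurent_over (A00 d). \<exists>v2\<in>laurent_over (A00 d). \<exists>A.
        w1 = Phi_laurent d G \<Phi> v1 \<and> w2 = Phi_laurent d G \<Phi> v2 \<and>
        expands_laurent d G u (v1 * hbar_flip v2) A \<and> c = A mx)"

text \<open>
  The axioms are bilinearity over \<open>\<complex>[[t]]\<close>, then (H1) to (H5). A series \<open>g \<in> \<complex>((\<hbar>))\<close>
  is viewed in \<open>\<complex>[[t]]((\<hbar>))\<close> through \<open>fls_map mps_const\<close>.
\<close>

definition modified_higher_residue_pairing ::
  "(complex \<Rightarrow> 'h::ab_group_add \<Rightarrow> 'h)
     \<Rightarrow> ('i::finite \<Rightarrow> ('i, 'h) mps fls \<Rightarrow> ('i, 'h) mps fls)
     \<Rightarrow> (('i, 'h) mps fls \<Rightarrow> ('i, 'h) mps fls)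
     \<Rightarrow> (('i, 'h) mps \<Rightarrow> ('i, 'h) mps \<Rightarrow> ('i, complex) mps)
     \<Rightarrow> (('i, 'h) mps fls \<Rightarrow> ('i, 'h) mps fls \<Rightarrow> ('i, complex) mps fls) \<Rightarrow> bool" where
  "modified_higher_residue_pairing sc nab nabh eta K \<longleftrightarrow>
     (\<forall>f w w' z. K (laurent_scale sc (fls_const f) w + w') z = fls_const f * K w z + K w' z) \<and>
     (\<forall>f w z z'. K w (laurent_scale sc (fls_const f) z + z') = fls_const f * K w z + K w z') \<and>
     (\<forall>w1 w2. K w1 w2 = hbar_flip (K w2 w1)) \<and>
     (\<forall>(g :: complex fls) w1 w2.
        fls_map mps_const g * K w1 w2 = K (laurent_scale sc (fls_map mps_const g) w1) w2 \<and>
        fls_map mps_const g * K w1 w2 = K w1 (laurent_scale sc (fls_map mps_const (hbar_flip g)) w2)) \<and>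
     (\<forall>\<alpha> w1 w2. fls_map (mps_deriv \<alpha>) (K w1 w2) = K (nab \<alpha> w1) w2 + K w1 (nab \<alpha> w2)) \<and>
     (\<forall>w1 w2. hbar_inv_deriv (K w1 w2) = K (nabh w1) w2 - K w1 (nabh w2)) \<and>
     (\<forall>w1 w2. (\<forall>j<0. fls_nth w1 j = 0) \<longrightarrow> (\<forall>j<0. fls_nth w2 j = 0) \<longrightarrow>
        (\<forall>j<0. fls_nth (K w1 w2) j = 0) \<and>
        fls_nth (K w1 w2) 0 = eta (fls_nth w1 0) (fls_nth w2 0))"

end

(*
  The exact elements form an ideal of the charge 0 subring A00 that is moreover stable under
  everything done coefficientwise, so the coefficient of u_max in a class of A00 / exact extends to
  a functional on A00[[t]]((hbar)) that commutes with the derivatives in t and in hbar, with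
  hbar -> - hbar and with scalars from C[[t]]((hbar)), and K is this functional applied to the
  product v1 * flip(v2) of representatives. Each axiom thus reduces to an identity for that product:
  the multiplication operators in the two connections cancel because hbar^-1 u_alpha changes sign
  under the flip while S + L does not, and what remains is the Leibniz rule, together with the
  anticommutation of the derivative in hbar^-1 with the flip.
*)
theory Submission
  imports Defs
begin

section \<open>Coefficientwise operations on series\<close>

lemma mps_nth_mps_map [simp]: "mps_nth (mps_map f F) m = f (mps_nth F m)"
  by (simp add: mps_map_def)

lemma mps_nth_sum [simp]: "mps_nth (sum f A) m = (\<Sum>x\<in>A. mps_nth (f x) m)"
  for f :: "_ \<Rightarrow> ('i, 'a::comm_monoid_add) mps"
  by (induction A rule: infinite_finite_induct) auto

lemma mps_nth_mps_deriv [simp]: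
  "mps_nth (mps_deriv \<alpha> f) m =
     of_nat (Poly_Mapping.lookup m \<alpha> + 1) * mps_nth f (m + Poly_Mapping.single \<alpha> 1)"
  by (simp add: mps_deriv_def)

lemma mps_map_0: "f 0 = 0 \<Longrightarrow> mps_map f 0 = 0"
  by (rule mps_eqI) simp

text \<open>\<open>Abs_fls\<close> is only specified on functions that vanish far enough to the
  left; the bound \<open>N\<close> supplies this for every operation built with
  \<open>Abs_fls\<close>.\<close>

lemma fls_nth_of_supported:
  assumes "\<And>j. j < N \<Longrightarrow> f j = 0"
  shows "fls_nth (Abs_fls f) j = f j"
  using assms by (intro nth_Abs_fls_lower_bound) auto

text \<open>With \<open>f 0 = 0\<close> the image vanishes below the subdegree of \<open>F\<close>,
  hence is again a Laurent series.\<close>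

lemma fls_nth_fls_map: "f 0 = 0 \<Longrightarrow> fls_nth (fls_map f F) j = f (fls_nth F j)"
  unfolding fls_map_def by (rule fls_nth_of_supported[of "fls_subdegree F"]) auto

lemma fls_nth_series_map:
  "f 0 = 0 \<Longrightarrow> fls_nth (series_map f F) j = mps_map f (fls_nth F j)"
  unfolding series_map_def by (simp add: fls_nth_fls_map mps_map_0)

lemma fls_nth_hbar_flip [simp]:
  "fls_nth (hbar_flip F) j = (if even j then fls_nth F j else - fls_nth F j)"
  unfolding hbar_flip_def by (rule fls_nth_of_supported[of "fls_subdegree F"]) auto

lemma fls_nth_hbar_inv_deriv [simp]:
  "fls_nth (hbar_inv_deriv F) j = - (of_int (j - 1) * fls_nth F (j - 1))"
  unfolding hbar_inv_deriv_def by (simp add: fls_X_power_times_conv_shift)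

lemma fls_nth_sum: "fls_nth (sum f A) j = (\<Sum>x\<in>A. fls_nth (f x) j)"
  for f :: "_ \<Rightarrow> 'a::comm_monoid_add fls"
  by (induction A rule: infinite_finite_induct) auto

lemma series_eqI:
  "(\<And>j m. mps_nth (fls_nth F j) m = mps_nth (fls_nth G j) m) \<Longrightarrow> F = G"
  by (rule fls_eqI, rule mps_eqI) blast

text \<open>Additivity is the standing hypothesis on coefficient maps: it provides
  \<open>f 0 = 0\<close> and passes from coefficients to series.\<close>

lemma additive_series_map: "additive f \<Longrightarrow> additive (series_map f)"
  by (intro additive.intro series_eqI) (simp add: fls_nth_series_map additive.zero additive.add)

lemma additive_mps_map: "additive f \<Longrightarrow> additive (mps_map f)"
  by (intro additive.intro mps_eqI) (simp add: additive.add)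

lemma additive_fls_map: "additive f \<Longrightarrow> additive (fls_map f)"
  by (intro additive.intro fls_eqI) (simp add: fls_nth_fls_map additive.zero additive.add)

lemma additive_mps_deriv: "additive (mps_deriv \<alpha> :: ('i, 'a::ring_1) mps \<Rightarrow> _)"
  by (intro additive.intro mps_eqI) (simp add: algebra_simps)

lemma laurent_overI:
  "(\<And>j m. mps_nth (fls_nth F j) m \<in> B) \<Longrightarrow> F \<in> laurent_over B"
  by (simp add: laurent_over_def power_over_def)

lemma laurent_overD: "F \<in> laurent_over B \<Longrightarrow> mps_nth (fls_nth F j) m \<in> B"
  by (simp add: laurent_over_def power_over_def)

lemma series_map_in_laurent_over:
  "f 0 = 0 \<Longrightarrow> (\<And>x. f x \<in> B) \<Longrightarrow> series_map f F \<in> laurent_over B"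
  by (simp add: laurent_overI fls_nth_series_map)

text \<open>Serves to replace a map that is only well behaved on \<open>B\<close> by one that is
  additive everywhere.\<close>

lemma series_map_cong:
  assumes "v \<in> laurent_over B" and "\<And>x. x \<in> B \<Longrightarrow> f x = g x" and "f 0 = 0" and "g 0 = 0"
  shows "series_map f v = series_map g v"
  by (rule series_eqI) (use assms in \<open>simp add: fls_nth_series_map laurent_overD\<close>)


section \<open>Products, the involution and derivations\<close>

text \<open>Any lower bounds may replace the subdegrees, since the extra terms vanish. A
  coefficientwise map can raise the subdegree, and this lets products before and after the map be
  summed over one common range.\<close>

lemma fls_times_nth_bounds:
  fixes f g :: "'a::comm_ring_1 fls"
  assumes a: "\<And>i. i < a \<Longrightarrow> fls_nth f i = 0" and b: "\<And>i. i < b \<Longrightarrow> fls_nth g i = 0"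
  shows "fls_nth (f * g) n = (\<Sum>i=a..n - b. fls_nth f i * fls_nth g (n - i))"
proof -
  let ?s = "\<lambda>i. fls_nth f i * fls_nth g (n - i)"
  let ?A = "{fls_subdegree f..n - fls_subdegree g}"
  have zero: "?s i = 0" if "i < a \<or> n - i < b \<or> i < fls_subdegree f \<or> n - i < fls_subdegree g" for i
    using that a[of i] b[of "n - i"] by auto
  have "sum ?s ?A = sum ?s {a..n - b}"
    by (rule sum.mono_neutral_cong) (auto intro!: zero simp del: mult_eq_0_iff)
  then show ?thesis by (simp add: fls_times_nth(2))
qed

text \<open>The signs attached to the exponents \<open>i\<close> and \<open>n - i\<close> multiply
  to the sign attached to \<open>n\<close>.\<close>

lemma hbar_flip_mult: "hbar_flip (f * g) = hbar_flip f * hbar_flip g"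
  for f g :: "'a::comm_ring_1 fls"
proof (rule fls_eqI)
  fix n
  have "fls_nth (hbar_flip f * hbar_flip g) n =
     (\<Sum>i=fls_subdegree f..n - fls_subdegree g. fls_nth (hbar_flip f) i * fls_nth (hbar_flip g) (n - i))"
    by (rule fls_times_nth_bounds) auto
  then show "fls_nth (hbar_flip (f * g)) n = fls_nth (hbar_flip f * hbar_flip g) n"
    by (auto simp: fls_times_nth(2) sum_negf[symmetric] intro!: sum.cong)
qed

lemma hbar_flip_hbar_flip [simp]: "hbar_flip (hbar_flip f) = f"
  by (rule fls_eqI) auto

lemma hbar_flip_add: "hbar_flip (f + g) = hbar_flip f + hbar_flip g"
  for f g :: "'a::ab_group_add fls"
  by (rule fls_eqI) auto

lemma hbar_flip_fls_const [simp]: "hbar_flip (fls_const c) = fls_const c"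
  by (rule fls_eqI) auto

lemma hbar_flip_fls_X_inv [simp]: "hbar_flip fls_X_inv = - (fls_X_inv :: 'a::comm_ring_1 fls)"
  by (rule fls_eqI) auto

text \<open>The derivative in hbar^-1 raises every exponent by one and so changes its parity. This
  is the source of the minus sign in (H4).\<close>

lemma hbar_inv_deriv_hbar_flip: "hbar_inv_deriv (hbar_flip f) = - hbar_flip (hbar_inv_deriv f)"
  by (rule fls_eqI) auto

lemma hbar_inv_deriv_mult:
  "hbar_inv_deriv (f * g) = hbar_inv_deriv f * g + f * hbar_inv_deriv g"
  by (simp add: hbar_inv_deriv_def algebra_simps)

lemma additive_hbar_inv_deriv: "additive hbar_inv_deriv"
  by (rule additive.intro) (simp add: hbar_inv_deriv_def algebra_simps)

lemma hbar_flip_fls_map: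
  assumes "additive D"
  shows "hbar_flip (fls_map D f) = fls_map D (hbar_flip f)"
  by (rule fls_eqI) (use assms in \<open>auto simp: fls_nth_fls_map additive.zero additive.minus\<close>)

lemma hbar_flip_series_map:
  assumes "additive f"
  shows "hbar_flip (series_map f v) = series_map f (hbar_flip v)"
  unfolding series_map_def by (intro hbar_flip_fls_map additive_mps_map assms)

text \<open>The Leibniz rule passes from the coefficient ring to Laurent series because
  \<open>D\<close> acts on the finite convolution sums termwise; it is needed for the derivatives in
  the t variables.\<close>

lemma fls_map_mult_derivation:
  fixes D :: "'a::comm_ring_1 \<Rightarrow> 'a"
  assumes D: "additive D" and Leibniz: "\<And>x y. D (x * y) = D x * y + x * D y"
  shows "fls_map D (f * g) = fls_map D f * g + f * fls_map D g"
proof (rule fls_eqI)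
  fix n
  let ?A = "{fls_subdegree f..n - fls_subdegree g}"
  note D0 = additive.zero[OF D]
  have "fls_nth (fls_map D f * g) n = (\<Sum>i\<in>?A. D (fls_nth f i) * fls_nth g (n - i))"
    by (subst fls_times_nth_bounds[where a = "fls_subdegree f" and b = "fls_subdegree g"])
       (auto simp: fls_nth_fls_map D0)
  moreover have "fls_nth (f * fls_map D g) n = (\<Sum>i\<in>?A. fls_nth f i * D (fls_nth g (n - i)))"
    by (subst fls_times_nth_bounds[where a = "fls_subdegree f" and b = "fls_subdegree g"])
       (auto simp: fls_nth_fls_map D0)
  ultimately show "fls_nth (fls_map D (f * g)) n = fls_nth (fls_map D f * g + f * fls_map D g) n"
    by (simp add: fls_nth_fls_map D0 fls_times_nth(2) additive.sum[OF D] Leibniz sum.distrib)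
qed

text \<open>The exponent of \<alpha> in \<open>m + e\<close> is the sum of its exponents in the two
  parts of a splitting. Distributing this factor gives two sums, and removing one \<open>e\<close>
  from the part that carries the factor yields the two Leibniz terms.\<close>

lemma mps_deriv_mult: "mps_deriv \<alpha> (f * g) = mps_deriv \<alpha> f * g + f * mps_deriv \<alpha> g"
  for f g :: "('i, 'a::comm_ring_1) mps"
proof (rule mps_eqI)
  fix m :: "'i \<Rightarrow>\<^sub>0 nat"
  define e where "e = (Poly_Mapping.single \<alpha> 1 :: 'i \<Rightarrow>\<^sub>0 nat)"
  let ?l = "\<lambda>a. of_nat (Poly_Mapping.lookup a \<alpha>) :: 'a"
  have le: "Poly_Mapping.lookup e \<alpha> = 1" by (simp add: e_def)
  have minus: "a - e + e = a" if "Poly_Mapping.lookup a \<alpha> \<noteq> 0" for a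
    using that by (intro poly_mapping_eqI) (auto simp: lookup_add lookup_minus e_def lookup_single when_def)
  have left: "(\<Sum>(a, b)\<in>splittings (m + e). ?l a * h a b) =
      (\<Sum>(a, b)\<in>splittings m. (?l a + 1) * h (a + e) b)" for h :: "_ \<Rightarrow> _ \<Rightarrow> 'a"
  proof -
    \<comment> \<open>Terms in which \<alpha> does not occur in \<open>a\<close> carry the factor 0.
      On the others the truncated subtraction of \<open>e\<close> is a genuine inverse of adding
      \<open>e\<close>.\<close>
    have "(\<Sum>(a, b)\<in>splittings (m + e). ?l a * h a b) =
        (\<Sum>(a, b)\<in>{(a, b)\<in>splittings (m + e). Poly_Mapping.lookup a \<alpha> \<noteq> 0}. ?l a * h a b)"
      by (rule sum.mono_neutral_right) (auto intro!: gr0I)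
    also have "\<dots> = (\<Sum>(a, b)\<in>splittings m. (?l a + 1) * h (a + e) b)"
    proof (rule sum.reindex_bij_witness[where i = "\<lambda>(a, b). (a + e, b)" and j = "\<lambda>(a, b). (a - e, b)"])
      fix p assume p: "p \<in> {(a, b)\<in>splittings (m + e). Poly_Mapping.lookup a \<alpha> \<noteq> 0}"
      obtain a b where ab: "p = (a, b)" by force
      have "a - e + b + e = m + e"
        using p minus[of a] by (simp add: ab splittings_def ac_simps)
      then show "(case p of (a, b) \<Rightarrow> (a - e, b)) \<in> splittings m"
        by (simp add: ab splittings_def)
      have "?l a = ?l (a - e) + 1"
        using minus[of a] p by (metis (mono_tags, lifting) ab case_prodD le lookup_add mem_Collect_eq of_nat_1 of_nat_add)
      then show "(case case p of (a, b) \<Rightarrow> (a - e, b) of (a, b) \<Rightarrow> (?l a + 1) * h (a + e) b) =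
            (case p of (a, b) \<Rightarrow> ?l a * h a b)"
        using p minus[of a] by (simp add: ab)
    qed (auto simp: splittings_def minus lookup_add le ac_simps minus[unfolded add.commute[of _ e]])
    finally show ?thesis .
  qed
  have right: "(\<Sum>(a, b)\<in>splittings (m + e). ?l b * h a b) =
      (\<Sum>(a, b)\<in>splittings m. (?l b + 1) * h a (b + e))" for h :: "_ \<Rightarrow> _ \<Rightarrow> 'a"
    using left[of "\<lambda>a b. h b a"] by (subst (1 2) splittings_swap)
  have "mps_nth (mps_deriv \<alpha> (f * g)) m =
      (\<Sum>(a, b)\<in>splittings (m + e). (?l a + ?l b) * (mps_nth f a * mps_nth g b))"
    unfolding mps_nth_mps_deriv mps_nth_times sum_distrib_left e_def[symmetric]
  proof (intro sum.cong refl, clarify)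
    fix a b assume "(a, b) \<in> splittings (m + e)"
    then have "Poly_Mapping.lookup m \<alpha> + 1 = Poly_Mapping.lookup a \<alpha> + Poly_Mapping.lookup b \<alpha>"
      using le by (metis (mono_tags) case_prodD lookup_add mem_Collect_eq splittings_def)
    then show "of_nat (Poly_Mapping.lookup m \<alpha> + 1) * (mps_nth f a * mps_nth g b) =
        (?l a + ?l b) * (mps_nth f a * mps_nth g b)"
      by (metis of_nat_add)
  qed
  also have "\<dots> = (\<Sum>(a, b)\<in>splittings m. (?l a + 1) * (mps_nth f (a + e) * mps_nth g b)) +
      (\<Sum>(a, b)\<in>splittings m. (?l b + 1) * (mps_nth f a * mps_nth g (b + e)))"
    unfolding left[of "\<lambda>a b. mps_nth f a * mps_nth g b", symmetric]
      right[of "\<lambda>a b. mps_nth f a * mps_nth g b", symmetric]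
    by (simp add: sum.distrib distrib_right case_prod_unfold)
  also have "\<dots> = mps_nth (mps_deriv \<alpha> f * g + f * mps_deriv \<alpha> g) m"
    unfolding mps_nth_plus mps_nth_times by (simp add: e_def algebra_simps)
  finally show "mps_nth (mps_deriv \<alpha> (f * g)) m = mps_nth (mps_deriv \<alpha> f * g + f * mps_deriv \<alpha> g) m" .
qed

text \<open>The derivative only shifts coefficients and multiplies them by integers, and an additive
  map respects integer multiples.\<close>

lemma series_map_hbar_inv_deriv:
  assumes "additive f"
  shows "series_map f (hbar_inv_deriv v) = hbar_inv_deriv (series_map f v)"
proof -
  have "mps_map f (of_nat n * x) = of_nat n * mps_map f x" for n x
    by (induction n) (simp_all add: mps_map_0 additive.zero[OF assms] additive.add[OF additive_mps_map[OF assms]] algebra_simps)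
  then have int: "mps_map f (of_int n * x) = of_int n * mps_map f x" for n x
    by (cases n rule: int_cases2) (simp_all add: additive.minus[OF additive_mps_map[OF assms]])
  then show ?thesis
    by (intro fls_eqI)
       (simp add: fls_nth_series_map additive.zero[OF assms] additive.minus[OF additive_mps_map[OF assms]]
          int del: of_int_diff)
qed

lemma series_map_mps_deriv:
  fixes f :: "'a::ring_1 \<Rightarrow> 'b::ring_1"
  assumes "additive f"
  shows "series_map f (fls_map (mps_deriv \<alpha>) v) = fls_map (mps_deriv \<alpha>) (series_map f v)"
proof -
  have nat: "f (of_nat n * x) = of_nat n * f x" for n x
    by (induction n) (simp_all add: additive.zero[OF assms] additive.add[OF assms] algebra_simps)
  show ?thesis
    by (rule series_eqI)
       (simp only: fls_nth_series_map fls_nth_fls_map additive.zero[OF assms]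
          additive.zero[OF additive_mps_deriv] mps_nth_mps_map mps_nth_mps_deriv nat)
qed

section \<open>Scalar multiplication of series by Laurent series\<close>

lemma laurent_scale_nth:
  assumes sc: "\<And>a. sc a 0 = 0" "\<And>x. sc 0 x = 0"
    and "\<And>i. i < a \<Longrightarrow> fls_nth c i = 0" and "\<And>i. i < b \<Longrightarrow> fls_nth w i = 0"
  shows "fls_nth (laurent_scale sc c w) n =
    (\<Sum>i=a..n - b. mps_scale sc (fls_nth c i) (fls_nth w (n - i)))"
proof -
  have [simp]: "mps_scale sc x 0 = 0" "mps_scale sc 0 y = 0" for x y
    by (auto intro!: mps_eqI simp: mps_scale_def sc)
  let ?s = "\<lambda>i. mps_scale sc (fls_nth c i) (fls_nth w (n - i))"
  let ?A = "{fls_subdegree c..n - fls_subdegree w}"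
  have zero: "?s i = 0" if "i < a \<or> n - i < b \<or> i < fls_subdegree c \<or> n - i < fls_subdegree w" for i
    using that assms(3)[of i] assms(4)[of "n - i"] by auto
  have "sum ?s ?A = sum ?s {a..n - b}"
    by (rule sum.mono_neutral_cong) (auto intro!: zero)
  then show ?thesis
    unfolding laurent_scale_def
    by (subst fls_nth_of_supported[of "fls_subdegree c + fls_subdegree w"]) auto
qed

lemma laurent_scale_times: "laurent_scale (*) c w = c * w"
  by (rule fls_eqI, subst laurent_scale_nth[where a = "fls_subdegree c" and b = "fls_subdegree w"])
     (auto simp: fls_times_nth(2) mps_scale_def times_mps_def)

text \<open>Here \<kappa> embeds the complex constants into the polynomial ring. One proof serves
  both maps on the Jacobian ring: the isomorphism onto \<open>'h\<close>, and the coefficient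
  functionals, for which \<open>sc\<close> is multiplication of complex numbers.\<close>

lemma series_map_semilinear:
  fixes f :: "'a::comm_ring_1 \<Rightarrow> 'h::ab_group_add" and \<kappa> :: "complex \<Rightarrow> 'a"
  assumes f: "additive f" and "\<kappa> 0 = 0" and lin: "\<And>a p. f (\<kappa> a * p) = sc a (f p)"
    and sc: "\<And>a. sc a 0 = 0" "\<And>x. sc 0 x = 0"
  shows "series_map f (series_map \<kappa> c * v) = laurent_scale sc c (series_map f v)"
proof (rule series_eqI)
  fix n m
  note [simp] = additive.zero[OF f] assms(2)
  have v0: "fls_nth (series_map f v) i = 0" if "i < fls_subdegree v" for i
    using that by (simp add: fls_nth_series_map mps_map_0)
  have "fls_nth (series_map \<kappa> c * v) n = (\<Sum>i=fls_subdegree c..n - fls_subdegree v.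
          fls_nth (series_map \<kappa> c) i * fls_nth v (n - i))"
    by (rule fls_times_nth_bounds) (auto simp: fls_nth_series_map mps_map_0)
  moreover have "fls_nth (laurent_scale sc c (series_map f v)) n =
      (\<Sum>i=fls_subdegree c..n - fls_subdegree v.
         mps_scale sc (fls_nth c i) (fls_nth (series_map f v) (n - i)))"
    by (rule laurent_scale_nth) (use sc v0 in auto)
  ultimately show "mps_nth (fls_nth (series_map f (series_map \<kappa> c * v)) n) m =
      mps_nth (fls_nth (laurent_scale sc c (series_map f v)) n) m"
    by (simp add: fls_nth_series_map additive.sum[OF f] mps_nth_times mps_scale_def lin case_prod_unfold)
qed


section \<open>The charge zero part and the exact ideal\<close>

definition charge :: "('k::finite \<Rightarrow> nat) \<Rightarrow> (('k + 'n::finite) \<Rightarrow>\<^sub>0 nat) \<Rightarrow> int" where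
  "charge d m = (\<Sum>i\<in>UNIV. int (Poly_Mapping.lookup m i) * var_charge d i)"

definition charged :: "('k::finite \<Rightarrow> nat) \<Rightarrow> int \<Rightarrow> ('k + 'n::finite) cpoly set" where
  "charged d c = {p. \<forall>m\<in>Poly_Mapping.keys p. charge d m = c}"

lemma charge_0 [simp]: "charge d 0 = 0"
  by (simp add: charge_def)

lemma charge_add: "charge d (a + b) = charge d a + charge d b"
  by (simp add: charge_def lookup_add algebra_simps sum.distrib)

lemma charge_sum: "charge d (sum f A) = (\<Sum>x\<in>A. charge d (f x))"
  by (induction A rule: infinite_finite_induct) (simp_all add: charge_add)

lemma charge_single: "charge d (Poly_Mapping.single i e) = int e * var_charge d i"
  unfolding charge_def lookup_single when_def
  by (subst sum.remove[of _ i]) (auto intro!: sum.neutral)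

text \<open>A polynomial sits at the empty set of odd variables, so its degree is 0 automatically
  and only the charge condition remains.\<close>

lemma A00_eq_charged: "A00 d = charged d 0"
  by (auto simp: A00_def A0_def graded_piece_def bv_of_poly_def charged_def charge_def)

lemma charged_0 [simp]: "0 \<in> charged d c"
  by (simp add: charged_def)

lemma charged_add: "p \<in> charged d c \<Longrightarrow> q \<in> charged d c \<Longrightarrow> p + q \<in> charged d c"
  using keys_add[of p q] by (auto simp: charged_def)

lemma charged_sum: "(\<And>x. x \<in> A \<Longrightarrow> f x \<in> charged d c) \<Longrightarrow> sum f A \<in> charged d c"
  by (induction A rule: infinite_finite_induct) (simp_all add: charged_add)

lemma charged_mult: "p \<in> charged d b \<Longrightarrow> q \<in> charged d c \<Longrightarrow> p * q \<in> charged d (b + c)"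
  using keys_mult[of p q] by (fastforce simp: charged_def charge_add)

lemma charged_single: "charge d m = c \<Longrightarrow> Poly_Mapping.single m a \<in> charged d c"
  by (auto simp: charged_def split: if_splits)

text \<open>Each x variable has charge 1, so charge is total degree here.\<close>

lemma embed_x_in_charged:
  assumes "homogeneous_poly e p"
  shows "embed_x p \<in> charged d (int e)"
  unfolding embed_x_def
proof (intro charged_sum charged_single)
  fix m assume "m \<in> Poly_Mapping.keys p"
  then have "(\<Sum>j\<in>UNIV. Poly_Mapping.lookup m j) = e"
    using assms by (simp add: homogeneous_poly_def)
  then show "charge d (\<Sum>j\<in>UNIV. Poly_Mapping.single (Inr j) (Poly_Mapping.lookup m j)) = int e"
    by (auto simp: charge_sum charge_single var_charge_def)
qed

text \<open>The charge \<open>- d l\<close> of the l-th y variable cancels the degree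
  \<open>d l\<close> of \<open>G l\<close>.\<close>

lemma action_S_in_A00:
  assumes "\<And>l. homogeneous_poly (d l) (G l)"
  shows "action_S G \<in> A00 d"
  unfolding action_S_def A00_eq_charged
proof (rule charged_sum)
  fix l
  have "Poly_Mapping.single (Poly_Mapping.single (Inl l) 1) 1 \<in> charged d (- int (d l))"
    by (rule charged_single) (simp add: charge_single var_charge_def)
  from charged_mult[OF this embed_x_in_charged[OF assms[of l]]]
  show "Poly_Mapping.single (Poly_Mapping.single (Inl l) 1) 1 * embed_x (G l) \<in> charged d 0"
    by simp
qed

text \<open>Turns complex scalars into ring elements of charge 0, so that closure under
  \<open>A00\<close> covers them.\<close>

lemma cmul_conv_mult: "cmul c p = cmul c 1 * p"
  by (simp add: cmul_def)

lemma lookup_cmul [simp]: "Poly_Mapping.lookup (cmul c p) m = c * Poly_Mapping.lookup p m"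
  unfolding cmul_def mult_map_scale_conv_mult[symmetric] by (simp add: Poly_Mapping.map.rep_eq when_def)

lemma cmul_in_A00: "cmul c 1 \<in> A00 d"
  by (simp add: A00_eq_charged cmul_def charged_single)

text \<open>The submodules over the ring \<open>A00\<close>. Both \<open>A00\<close> and the exact
  elements are instances, so each closure property of series is proved once for both.\<close>

definition charge_module :: "('k::finite \<Rightarrow> nat) \<Rightarrow> ('k + 'n::finite) cpoly set \<Rightarrow> bool" where
  "charge_module d B \<longleftrightarrow> 0 \<in> B \<and> (\<forall>x\<in>B. \<forall>y\<in>B. x + y \<in> B) \<and> (\<forall>r\<in>A00 d. \<forall>x\<in>B. r * x \<in> B)"

section \<open>Graded pieces of the super-algebra and the exact elements\<close>

lemma lookup_map_mult [simp]:
  "Poly_Mapping.lookup (Poly_Mapping.map ((*) r) a) T = r * Poly_Mapping.lookup a T"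
  for r :: "'a::comm_ring_1"
  by (simp add: Poly_Mapping.map.rep_eq when_def)

lemma graded_piece_iff:
  "a \<in> graded_piece g h c \<longleftrightarrow> (\<forall>T m. Poly_Mapping.lookup (Poly_Mapping.lookup a T) m \<noteq> 0 \<longrightarrow>
     (\<Sum>i\<in>UNIV. int (Poly_Mapping.lookup m i) * g i) + (\<Sum>i\<in>T. h i) = c)"
  by (force simp: graded_piece_def in_keys_iff)

lemma graded_piece_add:
  assumes "a \<in> graded_piece g h c" "b \<in> graded_piece g h c"
  shows "a + b \<in> graded_piece g h c"
  unfolding graded_piece_iff
proof (intro allI impI)
  fix T m assume "Poly_Mapping.lookup (Poly_Mapping.lookup (a + b) T) m \<noteq> 0"
  then have "Poly_Mapping.lookup (Poly_Mapping.lookup a T) m \<noteq> 0 \<or>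
      Poly_Mapping.lookup (Poly_Mapping.lookup b T) m \<noteq> 0"
    by (auto simp: lookup_add)
  then show "(\<Sum>i\<in>UNIV. int (Poly_Mapping.lookup m i) * g i) + (\<Sum>i\<in>T. h i) = c"
    using assms by (auto simp: graded_piece_iff)
qed

text \<open>Degrees add up under multiplication and \<open>r\<close> contributes 0. Used for both
  gradings that define \<open>A0\<close>.\<close>

lemma graded_piece_mult:
  assumes r: "bv_of_poly r \<in> graded_piece g h 0" and a: "a \<in> graded_piece g h c"
  shows "Poly_Mapping.map ((*) r) a \<in> graded_piece g h c"
  unfolding graded_piece_iff
proof (intro allI impI)
  fix T m assume "Poly_Mapping.lookup (Poly_Mapping.lookup (Poly_Mapping.map ((*) r) a) T) m \<noteq> 0"
  then have "m \<in> Poly_Mapping.keys (r * Poly_Mapping.lookup a T)"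
    by (simp add: in_keys_iff)
  then obtain m1 m2 where m: "m = m1 + m2" and "m1 \<in> Poly_Mapping.keys r"
    and "m2 \<in> Poly_Mapping.keys (Poly_Mapping.lookup a T)"
    using keys_mult by blast
  moreover from this have "(\<Sum>i\<in>UNIV. int (Poly_Mapping.lookup m1 i) * g i) = 0"
    using r[unfolded graded_piece_iff, rule_format, of "{}" m1] by (simp add: bv_of_poly_def in_keys_iff)
  moreover have "(\<Sum>i\<in>UNIV. int (Poly_Mapping.lookup m2 i) * g i) + (\<Sum>i\<in>T. h i) = c"
    using a calculation by (auto simp: graded_piece_iff in_keys_iff)
  ultimately show "(\<Sum>i\<in>UNIV. int (Poly_Mapping.lookup m i) * g i) + (\<Sum>i\<in>T. h i) = c"
    by (simp add: m lookup_add distrib_right sum.distrib)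
qed

text \<open>Only the components at singletons \<open>{i}\<close> are differentiated into the empty
  set, and there the sign exponent counts the elements of the empty set. The result is linear over
  all polynomials.\<close>

lemma Q_S_poly_eq:
  "Q_S_poly G a = (\<Sum>i\<in>UNIV. pdiff i (action_S G) * Poly_Mapping.lookup a {i})"
  by (simp add: Q_S_poly_def Q_S_def lookup_sum lookup_eta_diff)

lemma A00_mult: "p \<in> A00 d \<Longrightarrow> q \<in> A00 d \<Longrightarrow> p * q \<in> A00 d"
  using charged_mult[of p d 0 q 0] by (simp add: A00_eq_charged)

lemma A00_0 [simp]: "0 \<in> A00 d"
  by (simp add: A00_eq_charged)

lemma charge_module_A00: "charge_module d (A00 d)"
  unfolding charge_module_def using A00_mult by (auto simp: A00_eq_charged charged_add)

text \<open>\<open>Q_S_poly\<close> is linear over polynomials and multiplication by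
  \<open>A00\<close> preserves \<open>A0 d (- 1)\<close>. Independence of representatives in both
  pairings rests on this.\<close>

lemma charge_module_exact:
  fixes d :: "'k::{finite,linorder} \<Rightarrow> nat" and G :: "'k \<Rightarrow> 'n::{finite,linorder} cpoly"
  shows "charge_module d (exact d G)"
  unfolding charge_module_def
proof (intro conjI ballI)
  have "0 \<in> A0 d (- 1)" by (simp add: A0_def graded_piece_def)
  moreover have "Q_S_poly G 0 = 0" by (simp add: Q_S_poly_eq)
  ultimately show "0 \<in> exact d G" unfolding exact_def by (metis imageI)
next
  fix x y assume "x \<in> exact d G" "y \<in> exact d G"
  then obtain a b where ab: "a \<in> A0 d (- 1)" "b \<in> A0 d (- 1)" "x = Q_S_poly G a" "y = Q_S_poly G b"
    unfolding exact_def by blast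
  then have "a + b \<in> A0 d (- 1)" by (simp add: A0_def graded_piece_add)
  moreover have "x + y = Q_S_poly G (a + b)"
    by (simp add: ab Q_S_poly_eq lookup_add distrib_left sum.distrib)
  ultimately show "x + y \<in> exact d G" unfolding exact_def by blast
next
  fix r x :: "('k + 'n) cpoly" assume r: "r \<in> A00 d" and "x \<in> exact d G"
  then obtain a where a: "a \<in> A0 d (- 1)" "x = Q_S_poly G a"
    unfolding exact_def by blast
  have "Poly_Mapping.map ((*) r) a \<in> A0 d (- 1)"
    using r a(1) by (auto simp: A00_def A0_def graded_piece_mult)
  moreover have "r * x = Q_S_poly G (Poly_Mapping.map ((*) r) a)"
    by (simp add: a(2) Q_S_poly_eq sum_distrib_left ac_simps)
  ultimately show "r * x \<in> exact d G" unfolding exact_def by blast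
qed

lemma of_int_in_A00: "of_int k \<in> A00 d"
proof -
  have "of_int k = Poly_Mapping.single 0 (of_int k :: complex)"
    by simp
  then show ?thesis by (metis A00_eq_charged charged_single charge_0)
qed

section \<open>Laurent series with coefficients in a submodule\<close>

context
  fixes d :: "'k::finite \<Rightarrow> nat" and B :: "('k + 'n::finite) cpoly set"
  assumes B: "charge_module d B"
begin

lemma charge_module_0: "0 \<in> B"
  and charge_module_add: "x \<in> B \<Longrightarrow> y \<in> B \<Longrightarrow> x + y \<in> B"
  and charge_module_mult: "r \<in> A00 d \<Longrightarrow> x \<in> B \<Longrightarrow> r * x \<in> B"
  using B by (auto simp: charge_module_def)

lemma charge_module_of_int: "x \<in> B \<Longrightarrow> of_int k * x \<in> B"
  using charge_module_mult of_int_in_A00 by blast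

lemma charge_module_minus: "x \<in> B \<Longrightarrow> - x \<in> B"
  using charge_module_of_int[of x "- 1"] by simp

lemma charge_module_diff: "x \<in> B \<Longrightarrow> y \<in> B \<Longrightarrow> x - y \<in> B"
  using charge_module_add[of x "- y"] charge_module_minus by simp

lemma charge_module_sum: "(\<And>x. x \<in> A \<Longrightarrow> f x \<in> B) \<Longrightarrow> sum f A \<in> B"
  by (induction A rule: infinite_finite_induct) (simp_all add: charge_module_add charge_module_0)

lemma laurent_over_add: "v \<in> laurent_over B \<Longrightarrow> w \<in> laurent_over B \<Longrightarrow> v + w \<in> laurent_over B"
  by (rule laurent_overI) (simp add: laurent_overD charge_module_add)

lemma laurent_over_diff: "v \<in> laurent_over B \<Longrightarrow> w \<in> laurent_over B \<Longrightarrow> v - w \<in> laurent_over B"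
  by (rule laurent_overI) (simp add: laurent_overD charge_module_diff)

lemma laurent_over_minus: "v \<in> laurent_over B \<Longrightarrow> - v \<in> laurent_over B"
  by (rule laurent_overI) (simp add: laurent_overD charge_module_minus)

lemma laurent_over_hbar_flip: "v \<in> laurent_over B \<Longrightarrow> hbar_flip v \<in> laurent_over B"
  by (rule laurent_overI) (simp add: laurent_overD charge_module_minus)

lemma laurent_over_mps_deriv:
  "v \<in> laurent_over B \<Longrightarrow> fls_map (mps_deriv \<alpha>) v \<in> laurent_over B"
  using charge_module_of_int[where k = "int n" for n]
  by (intro laurent_overI)
     (simp add: fls_nth_fls_map additive.zero[OF additive_mps_deriv] laurent_overD
       del: of_nat_Suc of_nat_add)

lemma laurent_over_hbar_inv_deriv:
  assumes "v \<in> laurent_over B"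
  shows "hbar_inv_deriv v \<in> laurent_over B"
proof (rule laurent_overI)
  \<comment> \<open>Here \<open>of_nat k\<close> is itself a power series; the product has to be
    read as coefficientwise scaling before closure under integer multiples applies.\<close>
  have nat: "mps_nth (of_nat k * F) m = of_nat k * mps_nth F m" for k m and F :: "('i, ('k + 'n) cpoly) mps"
    by (induction k) (simp_all add: distrib_right)
  have int: "mps_nth (of_int k * F) m = of_int k * mps_nth F m" for k m and F :: "('i, ('k + 'n) cpoly) mps"
    by (cases k rule: int_cases2) (simp_all add: nat)
  fix j m
  show "mps_nth (fls_nth (hbar_inv_deriv v) j) m \<in> B"
    using assms by (simp add: int charge_module_minus charge_module_of_int laurent_overD del: of_int_diff)
qed

lemma laurent_over_mult:
  assumes "r \<in> laurent_over (A00 d)" "v \<in> laurent_over B"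
  shows "r * v \<in> laurent_over B"
  by (rule laurent_overI)
     (use assms in \<open>auto simp: fls_times_nth(2) mps_nth_times laurent_overD
        intro!: charge_module_sum charge_module_mult\<close>)

end

text \<open>
  Precomposed with the projection to charge 0, the maps on the Jacobian ring become linear on the
  whole polynomial ring, so that their linearity needs no membership conditions.
\<close>

definition charge_part :: "('k::finite \<Rightarrow> nat) \<Rightarrow> ('k + 'n::finite) cpoly \<Rightarrow> ('k + 'n) cpoly" where
  "charge_part d p = Poly_Mapping.Abs_poly_mapping (\<lambda>m. if charge d m = 0 then Poly_Mapping.lookup p m else 0)"

lemma lookup_charge_part:
  "Poly_Mapping.lookup (charge_part d p) m = (if charge d m = 0 then Poly_Mapping.lookup p m else 0)"
proof -
  have "finite {m. (if charge d m = 0 then Poly_Mapping.lookup p m else 0) \<noteq> 0}"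
    by (rule finite_subset[OF _ finite_keys[of p]]) (auto simp: in_keys_iff)
  then show ?thesis
    unfolding charge_part_def by (subst Abs_poly_mapping_inverse) auto
qed

lemma charge_part_in_A00 [simp]: "charge_part d p \<in> A00 d"
  by (auto simp: A00_eq_charged charged_def in_keys_iff lookup_charge_part split: if_splits)

lemma charge_part_eq: "p \<in> A00 d \<Longrightarrow> charge_part d p = p"
  by (rule poly_mapping_eqI)
     (auto simp: A00_eq_charged charged_def in_keys_iff lookup_charge_part)

lemma charge_part_add: "charge_part d (p + q) = charge_part d p + charge_part d q"
  by (rule poly_mapping_eqI) (simp add: lookup_charge_part lookup_add)

lemma charge_part_cmul: "charge_part d (cmul c p) = cmul c (charge_part d p)"
  by (rule poly_mapping_eqI) (simp add: lookup_charge_part)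


section \<open>Coefficients in the Jacobian ring\<close>

locale jacobian_ring =
  fixes d :: "'k::{finite,linorder} \<Rightarrow> nat"
    and G :: "'k \<Rightarrow> 'n::{finite,linorder} cpoly"
    and sc :: "complex \<Rightarrow> 'h::ab_group_add \<Rightarrow> 'h"
    and \<Phi> :: "('k + 'n) cpoly set \<Rightarrow> 'h"
    and u :: "'i::finite \<Rightarrow> ('k + 'n) cpoly"
  assumes homogeneous: "\<And>l. homogeneous_poly (d l) (G l)"
    and sc: "vector_space sc"
    and iso: "jacobian_iso d G sc \<Phi>"
    and basis: "jacobian_basis d G u"
begin

abbreviation "R \<equiv> A00 d"
abbreviation "E \<equiv> exact d G"

lemmas R = charge_module_A00[where d = d and ?'b = 'n]
lemmas E = charge_module_exact[of d G]

lemma u_in_R: "u \<alpha> \<in> R"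
  using basis by (simp add: jacobian_basis_def)

lemma cmul_mem: "charge_module d B \<Longrightarrow> p \<in> B \<Longrightarrow> cmul c p \<in> B"
  by (subst cmul_conv_mult) (simp add: charge_module_mult cmul_in_A00)

lemma combination_in_R: "(\<Sum>\<alpha>\<in>UNIV. cmul (c \<alpha>) (u \<alpha>)) \<in> R"
  by (intro charge_module_sum[OF R] cmul_mem[OF R] u_in_R)

lemma jclass_eq_iff:
  assumes "p \<in> R" "q \<in> R"
  shows "jclass d G p = jclass d G q \<longleftrightarrow> p - q \<in> E"
proof
  assume "jclass d G p = jclass d G q"
  moreover have "p \<in> jclass d G p"
    using assms charge_module_0[OF E] by (simp add: jclass_def)
  ultimately show "p - q \<in> E" by (simp add: jclass_def)
next
  assume pq: "p - q \<in> E"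
  have "x - p \<in> E \<longleftrightarrow> x - q \<in> E" for x
    using charge_module_add[OF E _ pq, of "x - p"] charge_module_diff[OF E _ pq, of "x - q"]
    by auto
  then show "jclass d G p = jclass d G q" by (simp add: jclass_def)
qed

text \<open>The coordinates with respect to the basis \<open>u\<close>, extended to all polynomials
  through \<open>charge_part\<close>.\<close>

definition coef :: "'i \<Rightarrow> ('k + 'n) cpoly \<Rightarrow> complex" where
  "coef \<rho> p = (THE c. jclass d G (charge_part d p) = jclass d G (\<Sum>\<alpha>\<in>UNIV. cmul (c \<alpha>) (u \<alpha>))) \<rho>"

text \<open>The unique existence in \<open>jacobian_basis\<close> as an equivalence: right to left,
  the coordinates leave an exact remainder; left to right, any coefficients that do so are the
  coordinates.\<close>

lemma coef_iff:
  assumes "p \<in> R"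
  shows "p - (\<Sum>\<alpha>\<in>UNIV. cmul (c \<alpha>) (u \<alpha>)) \<in> E \<longleftrightarrow> (\<forall>\<rho>. c \<rho> = coef \<rho> p)"
proof -
  define P where "P c \<longleftrightarrow> jclass d G (charge_part d p) = jclass d G (\<Sum>\<alpha>\<in>UNIV. cmul (c \<alpha>) (u \<alpha>))" for c
  have ex: "\<exists>!c. P c"
    using basis assms by (simp add: P_def jacobian_basis_def charge_part_eq)
  have "P c \<longleftrightarrow> c = The P"
  proof
    show "c = The P" if "P c"
      using the1_equality[OF ex, OF that] by simp
    show "P c" if "c = The P"
      using theI'[OF ex] that by simp
  qed
  then have "P c \<longleftrightarrow> (\<forall>\<rho>. c \<rho> = coef \<rho> p)"
    by (simp add: coef_def P_def[abs_def] fun_eq_iff)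
  then show ?thesis
    by (simp add: P_def charge_part_eq assms jclass_eq_iff combination_in_R)
qed

lemma coef_charge_part: "coef \<rho> (charge_part d p) = coef \<rho> p"
  by (simp add: coef_def charge_part_eq)

text \<open>The zero family is an expansion of \<open>p\<close>. Membership in \<open>R\<close> is
  carried along separately from membership in \<open>E\<close>.\<close>

lemma coef_exact:
  assumes "p \<in> R" "p \<in> E"
  shows "coef \<rho> p = 0"
  using coef_iff[OF assms(1), of "\<lambda>_. 0"] assms(2) by (simp add: cmul_def)

text \<open>The expected linear combination of coordinates leaves an exact remainder, because exact
  elements are closed under linear combinations; uniqueness of coordinates then decides.\<close>

lemma coef_linear: "coef \<rho> (cmul a p + q) = a * coef \<rho> p + coef \<rho> q"
proof -
  let ?p = "charge_part d p" and ?q = "charge_part d q"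
  define s where "s x = (\<Sum>\<alpha>\<in>UNIV. cmul (coef \<alpha> x) (u \<alpha>))" for x
  have "?p - s ?p \<in> E" "?q - s ?q \<in> E"
    unfolding s_def by (simp_all add: coef_iff)
  then have "cmul a (?p - s ?p) + (?q - s ?q) \<in> E"
    by (intro charge_module_add[OF E] cmul_mem[OF E])
  moreover have "cmul a (s ?p) + s ?q = (\<Sum>\<alpha>\<in>UNIV. cmul (a * coef \<alpha> p + coef \<alpha> q) (u \<alpha>))"
    by (rule poly_mapping_eqI)
       (simp add: s_def coef_charge_part lookup_sum lookup_add sum_distrib_left sum.distrib algebra_simps)
  moreover have "cmul a (?p - s ?p) + (?q - s ?q) = charge_part d (cmul a p + q) - (cmul a (s ?p) + s ?q)"
    by (rule poly_mapping_eqI)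
       (simp add: charge_part_add charge_part_cmul lookup_add lookup_minus algebra_simps)
  ultimately have "charge_part d (cmul a p + q) - (\<Sum>\<alpha>\<in>UNIV. cmul (a * coef \<alpha> p + coef \<alpha> q) (u \<alpha>)) \<in> E"
    by simp
  then show ?thesis
    by (simp add: coef_iff coef_charge_part)
qed

lemma additive_coef: "additive (coef \<rho>)"
  using coef_linear[of \<rho> 1] by (intro additive.intro) (simp add: cmul_def)

lemma coef_cmul: "coef \<rho> (cmul a 1 * p) = a * coef \<rho> p"
  using coef_linear[of \<rho> a p 0] additive.zero[OF additive_coef] by (simp add: cmul_conv_mult[symmetric])

lemmas coef_0 [simp] = additive.zero[OF additive_coef]

section \<open>The isomorphism onto the primitive cohomology and a section of it\<close>

definition phi :: "('k + 'n) cpoly \<Rightarrow> 'h" where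
  "phi p = \<Phi> (jclass d G (charge_part d p))"

lemma sc_0 [simp]: "sc a 0 = 0" "sc 0 x = 0"
proof -
  interpret vector_space sc by (rule sc)
  show "sc a 0 = 0" "sc 0 x = 0" by simp_all
qed

lemma phi_linear: "phi (cmul a p + q) = sc a (phi p) + phi q"
  using iso unfolding jacobian_iso_def phi_def by (simp add: charge_part_add charge_part_cmul)

lemma additive_phi: "additive phi"
proof -
  have "sc 1 x = x" for x
    using sc by (simp add: vector_space_def)
  then show ?thesis
    using phi_linear[of 1] by (intro additive.intro) (simp add: cmul_def)
qed

lemmas phi_0 [simp] = additive.zero[OF additive_phi]

lemma phi_cmul: "phi (cmul a 1 * p) = sc a (phi p)"
  using phi_linear[of a p 0] by (simp add: cmul_conv_mult[symmetric])

lemma phi_eq_iff: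
  assumes "p \<in> R" "q \<in> R"
  shows "phi p = phi q \<longleftrightarrow> p - q \<in> E"
proof -
  have "inj_on \<Phi> (jclass d G ` R)"
    using iso by (simp add: jacobian_iso_def bij_betw_def)
  then show ?thesis
    using assms jclass_eq_iff by (simp add: phi_def charge_part_eq inj_on_eq_iff)
qed

text \<open>A choice of representatives. The value at 0 is forced to be 0 so that the
  coefficientwise lift of a Laurent series is again one, with no new negative powers.\<close>

definition lift :: "'h \<Rightarrow> ('k + 'n) cpoly" where
  "lift h = (if h = 0 then 0 else SOME p. p \<in> R \<and> phi p = h)"

lemma lift_0 [simp]: "lift 0 = 0"
  by (simp add: lift_def)

text \<open>Surjectivity of \<Phi> provides the witness for the choice.\<close>

lemma lift_in_R: "lift h \<in> R" and phi_lift: "phi (lift h) = h"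
proof -
  have "\<Phi> ` jclass d G ` R = UNIV"
    using iso by (simp add: jacobian_iso_def bij_betw_def)
  then obtain p where "p \<in> R" "h = \<Phi> (jclass d G p)"
    by (metis (no_types, lifting) UNIV_I imageE)
  then have "\<exists>p. p \<in> R \<and> phi p = h"
    by (auto simp: phi_def charge_part_eq)
  then have "(SOME p. p \<in> R \<and> phi p = h) \<in> R \<and> phi (SOME p. p \<in> R \<and> phi p = h) = h"
    by (rule someI_ex)
  then show "lift h \<in> R" "phi (lift h) = h"
    by (auto simp: lift_def)
qed

lemma phi_eq_jclass: "p \<in> R \<Longrightarrow> \<Phi> (jclass d G p) = phi p"
  by (simp add: phi_def charge_part_eq)


subsection \<open>Series\<close>

abbreviation "LR \<equiv> laurent_over R :: ('i, ('k + 'n) cpoly) mps fls set"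
abbreviation "LE \<equiv> laurent_over E :: ('i, ('k + 'n) cpoly) mps fls set"

lemma Phi_laurent_eq: "v \<in> LR \<Longrightarrow> Phi_laurent d G \<Phi> v = series_map phi v"
  unfolding Phi_laurent_def
  by (rule series_map_cong) (auto simp: phi_eq_jclass)

lemma Phi_power_eq: "v \<in> power_over R \<Longrightarrow> Phi_power d G \<Phi> v = mps_map phi v"
  unfolding Phi_power_def
  by (rule mps_eqI) (auto simp: phi_eq_jclass power_over_def)

lemma series_map_lift: "series_map lift w \<in> LR" "Phi_laurent d G \<Phi> (series_map lift w) = w"
proof -
  show *: "series_map lift w \<in> LR"
    by (simp add: series_map_in_laurent_over lift_in_R)
  show "Phi_laurent d G \<Phi> (series_map lift w) = w"
    by (rule series_eqI) (simp add: Phi_laurent_eq * fls_nth_series_map phi_lift)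
qed

lemma Phi_laurent_eq_iff:
  assumes "v \<in> LR" "v' \<in> LR"
  shows "Phi_laurent d G \<Phi> v = Phi_laurent d G \<Phi> v' \<longleftrightarrow> v - v' \<in> LE"
proof -
  have "Phi_laurent d G \<Phi> v = Phi_laurent d G \<Phi> v' \<longleftrightarrow>
      (\<forall>j m. phi (mps_nth (fls_nth v j) m) = phi (mps_nth (fls_nth v' j) m))"
    using assms by (auto simp: Phi_laurent_eq fls_eq_iff fls_nth_series_map intro: mps_eqI)
      (metis mps_nth_mps_map)
  also have "\<dots> \<longleftrightarrow> v - v' \<in> LE"
    using assms by (simp add: phi_eq_iff laurent_overD) (auto simp: laurent_over_def power_over_def)
  finally show ?thesis .
qed

text \<open>An additive operator preserving \<open>LR\<close> and \<open>LE\<close> descends to the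
  quotient, which evaluates the definite descriptions. Only additivity is asked of \<open>T\<close>,
  since connections are not linear over the series.\<close>

lemma lifted_operator_eq:
  assumes T: "additive T" "\<And>v. v \<in> LR \<Longrightarrow> T v \<in> LR" "\<And>v. v \<in> LE \<Longrightarrow> T v \<in> LE"
    and v: "v \<in> LR"
  shows "(THE w'. \<exists>x\<in>LR. Phi_laurent d G \<Phi> v = Phi_laurent d G \<Phi> x \<and> w' = Phi_laurent d G \<Phi> (T x)) =
    Phi_laurent d G \<Phi> (T v)"
proof (rule the_equality)
  fix w' assume "\<exists>x\<in>LR. Phi_laurent d G \<Phi> v = Phi_laurent d G \<Phi> x \<and> w' = Phi_laurent d G \<Phi> (T x)"
  then obtain x where x: "x \<in> LR" "x - v \<in> LE" "w' = Phi_laurent d G \<Phi> (T x)"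
    using v Phi_laurent_eq_iff by metis
  then have "T x - T v \<in> LE"
    using T(1,3) by (metis additive.diff)
  then show "w' = Phi_laurent d G \<Phi> (T v)"
    using x v T(2) by (simp add: Phi_laurent_eq_iff)
qed (use v in blast)

lemma coef_series_cong:
  assumes "v \<in> LR" "v' \<in> LR" "v - v' \<in> LE"
  shows "series_map (coef \<rho>) v = series_map (coef \<rho>) v'"
proof -
  have "v - v' \<in> LR"
    using assms laurent_over_diff[OF R] by blast
  then have "series_map (coef \<rho>) (v - v') = 0"
    using assms(3) by (intro series_eqI) (simp add: fls_nth_series_map coef_exact laurent_overD del: fls_minus_nth)
  then show ?thesis
    by (simp add: additive.diff[OF additive_series_map[OF additive_coef]])
qed

text \<open>A chosen preimage under \<open>Q_S_poly\<close>, normalised at 0 for the same reason as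
  \<open>lift\<close>.\<close>

definition potential :: "('k + 'n) cpoly \<Rightarrow> ('k, 'n) bv" where
  "potential p = (if p = 0 then 0 else SOME a. a \<in> A0 d (- 1) \<and> Q_S_poly G a = p)"

lemma potential_0 [simp]: "potential 0 = 0"
  by (simp add: potential_def)

lemma Q_S_poly_0 [simp]: "Q_S_poly G 0 = 0"
  by (simp add: Q_S_poly_eq)

lemma potential:
  assumes "p \<in> E"
  shows "potential p \<in> A0 d (- 1)" "Q_S_poly G (potential p) = p"
proof -
  have "0 \<in> A0 d (- 1)" by (simp add: A0_def graded_piece_def)
  moreover have "\<exists>a. a \<in> A0 d (- 1) \<and> Q_S_poly G a = p"
    using assms by (auto simp: exact_def)
  then have "(SOME a. a \<in> A0 d (- 1) \<and> Q_S_poly G a = p) \<in> A0 d (- 1) \<and>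
      Q_S_poly G (SOME a. a \<in> A0 d (- 1) \<and> Q_S_poly G a = p) = p"
    by (rule someI_ex)
  ultimately show "potential p \<in> A0 d (- 1)" "Q_S_poly G (potential p) = p"
    by (auto simp: potential_def)
qed

section \<open>Expansions in the basis\<close>

lemma coef_eqI:
  assumes "p \<in> R" "a \<in> A0 d (- 1)" "p = (\<Sum>\<rho>\<in>UNIV. cmul (c \<rho>) (u \<rho>)) + Q_S_poly G a"
  shows "c \<rho> = coef \<rho> p"
proof -
  have "p - (\<Sum>\<rho>\<in>UNIV. cmul (c \<rho>) (u \<rho>)) \<in> E"
    using assms by (simp add: exact_def)
  then show ?thesis using coef_iff[OF assms(1)] by blast
qed

lemma cmul_0 [simp]: "cmul 0 p = 0"
  by (simp add: cmul_def)

text \<open>Existence and uniqueness of the expansion at once. Comparing coefficients of an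
  expansion forces the coordinates; conversely the remainder is exact in each coefficient, and
  \<open>potential\<close> assembles the preimages into one Laurent series.\<close>

lemma expands_laurent_iff:
  assumes v: "v \<in> LR"
  shows "expands_laurent d G u v A \<longleftrightarrow> A = (\<lambda>\<rho>. series_map (coef \<rho>) v)"
proof
  assume "expands_laurent d G u v A"
  then obtain \<Lambda> where \<Lambda>: "\<Lambda> \<in> laurent_over (A0 d (- 1))"
    and eq: "v = (\<Sum>\<rho>\<in>UNIV. series_map (\<lambda>c. cmul c (u \<rho>)) (A \<rho>)) + series_map (Q_S_poly G) \<Lambda>"
    unfolding expands_laurent_def by blast
  have "mps_nth (fls_nth (A \<rho>) j) m = coef \<rho> (mps_nth (fls_nth v j) m)" for \<rho> j m
  proof (rule coef_eqI)
    show "mps_nth (fls_nth v j) m = (\<Sum>\<rho>\<in>UNIV. cmul (mps_nth (fls_nth (A \<rho>) j) m) (u \<rho>)) +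
        Q_S_poly G (mps_nth (fls_nth \<Lambda> j) m)"
      by (subst eq) (simp add: fls_nth_sum fls_nth_series_map)
  qed (use v \<Lambda> laurent_overD in auto)
  then show "A = (\<lambda>\<rho>. series_map (coef \<rho>) v)"
    by (intro ext series_eqI) (simp add: fls_nth_series_map)
next
  assume A: "A = (\<lambda>\<rho>. series_map (coef \<rho>) v)"
  let ?r = "v - (\<Sum>\<rho>\<in>UNIV. series_map (\<lambda>c. cmul c (u \<rho>)) (A \<rho>))"
  have r: "?r \<in> LE"
    using v by (intro laurent_overI) (simp add: fls_nth_sum fls_nth_series_map A coef_iff laurent_overD)
  have "series_map potential ?r \<in> laurent_over (A0 d (- 1))"
    using laurent_overD[OF r] potential(1) by (intro laurent_overI) (simp only: fls_nth_series_map potential_0 mps_nth_mps_map)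
  moreover have "series_map (Q_S_poly G) (series_map potential ?r) = ?r"
    using laurent_overD[OF r] potential(2)
    by (intro series_eqI) (simp only: fls_nth_series_map potential_0 Q_S_poly_0 mps_nth_mps_map)
  then have "v = (\<Sum>\<rho>\<in>UNIV. series_map (\<lambda>c. cmul c (u \<rho>)) (A \<rho>)) +
      series_map (Q_S_poly G) (series_map potential ?r)"
    by simp
  ultimately show "expands_laurent d G u v A"
    unfolding expands_laurent_def by blast
qed

lemma expands_power_iff:
  assumes v: "v \<in> power_over R"
  shows "expands_power d G u v A \<longleftrightarrow> A = (\<lambda>\<rho>. mps_map (coef \<rho>) v)"
proof
  assume "expands_power d G u v A"
  then obtain \<Lambda> where \<Lambda>: "\<Lambda> \<in> power_over (A0 d (- 1))"
    and eq: "v = (\<Sum>\<rho>\<in>UNIV. mps_map (\<lambda>c. cmul c (u \<rho>)) (A \<rho>)) + mps_map (Q_S_poly G) \<Lambda>"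
    unfolding expands_power_def by blast
  have "mps_nth (A \<rho>) m = coef \<rho> (mps_nth v m)" for \<rho> m
  proof (rule coef_eqI)
    show "mps_nth v m = (\<Sum>\<rho>\<in>UNIV. cmul (mps_nth (A \<rho>) m) (u \<rho>)) + Q_S_poly G (mps_nth \<Lambda> m)"
      by (subst eq) simp
  qed (use v \<Lambda> in \<open>auto simp: power_over_def\<close>)
  then show "A = (\<lambda>\<rho>. mps_map (coef \<rho>) v)"
    by (intro ext mps_eqI) simp
next
  assume A: "A = (\<lambda>\<rho>. mps_map (coef \<rho>) v)"
  let ?r = "v - (\<Sum>\<rho>\<in>UNIV. mps_map (\<lambda>c. cmul c (u \<rho>)) (A \<rho>))"
  have r: "mps_nth ?r m \<in> E" for m
    using v by (simp add: A coef_iff power_over_def)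
  have "mps_map potential ?r \<in> power_over (A0 d (- 1))"
    unfolding power_over_def using potential(1)[OF r] by (simp only: mps_nth_mps_map mem_Collect_eq) blast
  moreover have "mps_map (Q_S_poly G) (mps_map potential ?r) = ?r"
    using r potential(2) by (intro mps_eqI) (simp only: mps_nth_mps_map)
  then have "v = (\<Sum>\<rho>\<in>UNIV. mps_map (\<lambda>c. cmul c (u \<rho>)) (A \<rho>)) +
      mps_map (Q_S_poly G) (mps_map potential ?r)"
    by simp
  ultimately show "expands_power d G u v A"
    unfolding expands_power_def by blast
qed


subsection \<open>The connections and the pairings on representatives\<close>

lemma obtain_lift:
  obtains v where "v \<in> LR" "w = Phi_laurent d G \<Phi> v"
  using series_map_lift by metis

lemma one_in_R: "1 \<in> R"
  using of_int_in_A00[of 1 d] by simp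

lemma fls_const_in_LR: "c \<in> power_over R \<Longrightarrow> fls_const c \<in> LR"
  by (rule laurent_overI) (simp add: power_over_def)

lemma fls_X_inv_in_LR: "fls_X_inv \<in> LR"
  by (rule laurent_overI) (simp add: mps_nth_one one_in_R)

lemma mps_const_in_power_over: "p \<in> R \<Longrightarrow> mps_const p \<in> power_over R"
  by (simp add: power_over_def mps_const_def)

lemma def_L_in_power_over: "def_L u \<in> power_over R"
  unfolding power_over_def def_L_def
  by (auto simp: mps_nth_times mps_var_def mps_const_def u_in_R one_in_R
      intro!: charge_module_sum[OF R] charge_module_mult[OF R])

definition nabla_rep where
  "nabla_rep \<alpha> v = fls_map (mps_deriv \<alpha>) v + fls_X_inv * fls_const (mps_const (u \<alpha>)) * v"

definition nabla_hbar_inv_rep where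
  "nabla_hbar_inv_rep v = hbar_inv_deriv v + fls_const (mps_const (action_S G) + def_L u) * v"

lemma additive_nabla_rep: "additive (nabla_rep \<alpha>)"
  unfolding nabla_rep_def
  by (intro additive.intro)
     (simp add: additive.add[OF additive_fls_map[OF additive_mps_deriv]] algebra_simps)

lemma additive_nabla_hbar_inv_rep: "additive nabla_hbar_inv_rep"
  unfolding nabla_hbar_inv_rep_def
  by (intro additive.intro) (simp add: additive.add[OF additive_hbar_inv_deriv] algebra_simps)

text \<open>Taking \<open>R\<close> and \<open>E\<close> for \<open>B\<close> gives the two
  invariance conditions of \<open>lifted_operator_eq\<close>.\<close>

lemma nabla_rep_closed:
  assumes "charge_module d B" "v \<in> laurent_over B"
  shows "nabla_rep \<alpha> v \<in> laurent_over B"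
  unfolding nabla_rep_def
  by (intro laurent_over_add[OF assms(1)] laurent_over_mult[OF assms(1)] laurent_over_mult[OF R]
      laurent_over_mps_deriv[OF assms(1)] fls_X_inv_in_LR fls_const_in_LR mps_const_in_power_over u_in_R assms(2))

lemma nabla_hbar_inv_rep_closed:
  assumes "charge_module d B" "v \<in> laurent_over B"
  shows "nabla_hbar_inv_rep v \<in> laurent_over B"
proof -
  \<comment> \<open>Homogeneity of the \<open>G l\<close> enters here, through the charge of
    \<open>action_S G\<close>.\<close>
  have "mps_const (action_S G) + def_L u \<in> power_over R"
    using mps_const_in_power_over[OF action_S_in_A00[OF homogeneous]] def_L_in_power_over
    by (auto simp: power_over_def intro: charge_module_add[OF R])
  then show ?thesis
    unfolding nabla_hbar_inv_rep_def
    by (intro laurent_over_add[OF assms(1)] laurent_over_mult[OF assms(1)]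
        laurent_over_hbar_inv_deriv[OF assms(1)] fls_const_in_LR assms(2))
qed

lemma nabla_eq:
  assumes "v \<in> LR"
  shows "nabla d G u \<Phi> \<alpha> (Phi_laurent d G \<Phi> v) = Phi_laurent d G \<Phi> (nabla_rep \<alpha> v)"
  unfolding nabla_def nabla_rep_def[symmetric]
  by (rule lifted_operator_eq[OF additive_nabla_rep nabla_rep_closed[OF R] nabla_rep_closed[OF E] assms])

lemma nabla_hbar_inv_eq:
  assumes "v \<in> LR"
  shows "nabla_hbar_inv d G u \<Phi> (Phi_laurent d G \<Phi> v) = Phi_laurent d G \<Phi> (nabla_hbar_inv_rep v)"
  unfolding nabla_hbar_inv_def nabla_hbar_inv_rep_def[symmetric]
  by (rule lifted_operator_eq[OF additive_nabla_hbar_inv_rep nabla_hbar_inv_rep_closed[OF R]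
        nabla_hbar_inv_rep_closed[OF E] assms])

lemma product_in_LR: "v1 \<in> LR \<Longrightarrow> v2 \<in> LR \<Longrightarrow> v1 * hbar_flip v2 \<in> LR"
  by (intro laurent_over_mult[OF R] laurent_over_hbar_flip[OF R])

text \<open>Evaluates the definite description: changing representatives alters the product by an
  exact series, which the coordinate functional does not see.\<close>

lemma residue_pairing_eq:
  assumes v: "v1 \<in> LR" "v2 \<in> LR"
  shows "residue_pairing d G u mx \<Phi> (Phi_laurent d G \<Phi> v1) (Phi_laurent d G \<Phi> v2) =
    series_map (coef mx) (v1 * hbar_flip v2)"
  unfolding residue_pairing_def
proof (rule the_equality)
  show "\<exists>x1\<in>LR. \<exists>x2\<in>LR. \<exists>A. Phi_laurent d G \<Phi> v1 = Phi_laurent d G \<Phi> x1 \<and>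
      Phi_laurent d G \<Phi> v2 = Phi_laurent d G \<Phi> x2 \<and>
      expands_laurent d G u (x1 * hbar_flip x2) A \<and>
      series_map (coef mx) (v1 * hbar_flip v2) = A mx"
    using v by (auto simp: expands_laurent_iff product_in_LR)
next
  fix c
  assume "\<exists>x1\<in>LR. \<exists>x2\<in>LR. \<exists>A. Phi_laurent d G \<Phi> v1 = Phi_laurent d G \<Phi> x1 \<and>
      Phi_laurent d G \<Phi> v2 = Phi_laurent d G \<Phi> x2 \<and>
      expands_laurent d G u (x1 * hbar_flip x2) A \<and> c = A mx"
  then obtain x1 x2 where x: "x1 \<in> LR" "x2 \<in> LR" "v1 - x1 \<in> LE" "v2 - x2 \<in> LE"
    and c: "c = series_map (coef mx) (x1 * hbar_flip x2)"
    using v by (auto simp: Phi_laurent_eq_iff expands_laurent_iff product_in_LR)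
  \<comment> \<open>One factor is changed at a time. The flip preserves \<open>LE\<close>, since
    exact elements are closed under negation.\<close>
  have "x1 * hbar_flip x2 - v1 * hbar_flip v2 =
      - (hbar_flip x2 * (v1 - x1) + v1 * hbar_flip (v2 - x2))"
    using hbar_flip_add[of "v2 - x2" x2] by (simp add: algebra_simps)
  also have "\<dots> \<in> LE"
    using x v
    by (intro laurent_over_minus[OF E] laurent_over_add[OF E] laurent_over_mult[OF E]
        laurent_over_hbar_flip[OF E] laurent_over_hbar_flip[OF R])
  finally show "c = series_map (coef mx) (v1 * hbar_flip v2)"
    unfolding c using x v by (intro coef_series_cong product_in_LR)
qed

text \<open>The same argument without hbar, carried out on the coefficient at each monomial.\<close>

lemma eta_pairing_eq:
  assumes v: "v1 \<in> power_over R" "v2 \<in> power_over R"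
  shows "eta_pairing d G u mx \<Phi> (Phi_power d G \<Phi> v1) (Phi_power d G \<Phi> v2) =
    mps_map (coef mx) (v1 * v2)"
  unfolding eta_pairing_def
proof (rule the_equality)
  have prod: "x * y \<in> power_over R" if "x \<in> power_over R" "y \<in> power_over R"
    for x y :: "('i, ('k + 'n) cpoly) mps"
    using that by (auto simp: power_over_def mps_nth_times intro!: charge_module_sum[OF R] A00_mult)
  show "\<exists>x1\<in>power_over R. \<exists>x2\<in>power_over R. \<exists>A. Phi_power d G \<Phi> v1 = Phi_power d G \<Phi> x1 \<and>
      Phi_power d G \<Phi> v2 = Phi_power d G \<Phi> x2 \<and>
      expands_power d G u (x1 * x2) A \<and> mps_map (coef mx) (v1 * v2) = A mx"
    using v by (auto simp: expands_power_iff prod)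
  fix c
  assume "\<exists>x1\<in>power_over R. \<exists>x2\<in>power_over R. \<exists>A. Phi_power d G \<Phi> v1 = Phi_power d G \<Phi> x1 \<and>
      Phi_power d G \<Phi> v2 = Phi_power d G \<Phi> x2 \<and> expands_power d G u (x1 * x2) A \<and> c = A mx"
  then obtain x1 x2 where x: "x1 \<in> power_over R" "x2 \<in> power_over R"
    and "mps_map phi v1 = mps_map phi x1" "mps_map phi v2 = mps_map phi x2"
    and c: "c = mps_map (coef mx) (x1 * x2)"
    using v by (auto simp: Phi_power_eq expands_power_iff prod)
  then have e: "mps_nth v1 m - mps_nth x1 m \<in> E" "mps_nth v2 m - mps_nth x2 m \<in> E" for m
    using v unfolding power_over_def mem_Collect_eq by (metis mps_nth_mps_map phi_eq_iff)+
  show "c = mps_map (coef mx) (v1 * v2)"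
    unfolding c
  proof (rule mps_eqI)
    fix m
    have "mps_nth (v1 * v2) m - mps_nth (x1 * x2) m = (\<Sum>(a, b)\<in>splittings m.
        mps_nth x2 b * (mps_nth v1 a - mps_nth x1 a) + mps_nth v1 a * (mps_nth v2 b - mps_nth x2 b))"
      unfolding mps_nth_times sum_subtractf[symmetric]
      by (intro sum.cong) (auto simp: algebra_simps)
    also have "\<dots> \<in> E"
      using x v e by (auto simp: power_over_def
          intro!: charge_module_sum[OF E] charge_module_add[OF E] charge_module_mult[OF E])
    finally have "coef mx (mps_nth (v1 * v2) m - mps_nth (x1 * x2) m) = 0"
      using prod[OF x] prod[OF v]
      by (intro coef_exact charge_module_diff[OF R]) (auto simp: power_over_def)
    then show "mps_nth (mps_map (coef mx) (x1 * x2)) m = mps_nth (mps_map (coef mx) (v1 * v2)) m"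
      by (simp add: additive.diff[OF additive_coef])
  qed
qed


subsection \<open>The axioms\<close>

text \<open>The image of a complex Laurent series among the polynomial ones, which makes scalar
  multiplication an ordinary product of representatives.\<close>

abbreviation "scalar c \<equiv> series_map (\<lambda>a. cmul a 1) c :: ('i, ('k + 'n) cpoly) mps fls"

lemma scalar_in_LR: "scalar c \<in> LR"
  by (simp add: series_map_in_laurent_over cmul_in_A00)

lemma laurent_scale_Phi:
  assumes "v \<in> LR"
  shows "laurent_scale sc c (Phi_laurent d G \<Phi> v) = Phi_laurent d G \<Phi> (scalar c * v)"
  using assms laurent_over_mult[OF R scalar_in_LR assms]
  by (simp add: Phi_laurent_eq series_map_semilinear[OF additive_phi _ phi_cmul])

lemma coef_scalar: "series_map (coef \<rho>) (scalar c * v) = c * series_map (coef \<rho>) v"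
  by (simp add: series_map_semilinear[OF additive_coef _ coef_cmul] laurent_scale_times)

lemma Phi_laurent_add:
  assumes "v \<in> LR" "v' \<in> LR"
  shows "Phi_laurent d G \<Phi> v + Phi_laurent d G \<Phi> v' = Phi_laurent d G \<Phi> (v + v')"
  using assms laurent_over_add[OF R assms]
  by (simp add: Phi_laurent_eq additive.add[OF additive_series_map[OF additive_phi]])

lemmas coef_add = additive.add[OF additive_series_map[OF additive_coef]]
lemmas coef_diff = additive.diff[OF additive_series_map[OF additive_coef]]

abbreviation "K mx \<equiv> residue_pairing d G u mx \<Phi>"

text \<open>Stated for an arbitrary Laurent series \<open>c\<close>, it covers both the bilinearity
  in the first argument and the first half of (H2).\<close>

lemma pairing_linear_left: "K mx (laurent_scale sc c w + w') z = c * K mx w z + K mx w' z"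
proof -
  obtain v v' y where v: "v \<in> LR" "w = Phi_laurent d G \<Phi> v" "v' \<in> LR" "w' = Phi_laurent d G \<Phi> v'"
    "y \<in> LR" "z = Phi_laurent d G \<Phi> y" by (metis obtain_lift)
  have "scalar c * v \<in> LR" using v scalar_in_LR laurent_over_mult[OF R] by blast
  moreover from this have "scalar c * v + v' \<in> LR" using v laurent_over_add[OF R] by blast
  ultimately show ?thesis
    using v by (simp add: laurent_scale_Phi Phi_laurent_add residue_pairing_eq distrib_right
        mult.assoc coef_add coef_scalar)
qed

text \<open>The flip is a multiplicative involution, so it carries \<open>v2 * hbar_flip v1\<close>
  to \<open>v1 * hbar_flip v2\<close>, and it commutes with the coordinate functional.\<close>

lemma pairing_symmetric: "K mx w1 w2 = hbar_flip (K mx w2 w1)"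
proof -
  obtain v1 v2 where v: "v1 \<in> LR" "w1 = Phi_laurent d G \<Phi> v1" "v2 \<in> LR" "w2 = Phi_laurent d G \<Phi> v2"
    by (metis obtain_lift)
  then show ?thesis
    by (simp add: residue_pairing_eq hbar_flip_series_map[OF additive_coef] hbar_flip_mult mult.commute)
qed

text \<open>Follows from the left version by symmetry, which flips the scalar; scalars constant in
  hbar are unaffected.\<close>

lemma pairing_linear_right:
  "K mx w (laurent_scale sc c z + z') = hbar_flip c * K mx w z + K mx w z'"
  by (subst (1 2 3) pairing_symmetric)
     (simp add: pairing_linear_left hbar_flip_add hbar_flip_mult)

lemma pairing_scale:
  "K mx (laurent_scale sc c w) z = c * K mx w z"
  "K mx w (laurent_scale sc c z) = hbar_flip c * K mx w z"
proof -
  have 0: "(0 :: ('i, ('k + 'n) cpoly) mps fls) \<in> LR"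
    by (simp add: laurent_overI)
  moreover have "Phi_laurent d G \<Phi> (0 :: ('i, ('k + 'n) cpoly) mps fls) = 0"
    by (rule series_eqI) (simp add: Phi_laurent_eq 0 fls_nth_series_map)
  moreover have "series_map (coef mx) 0 = 0"
    by (rule series_eqI) (simp add: fls_nth_series_map)
  \<comment> \<open>The zero series represents zero, so the extra summand in the linearity lemmas
    can be set to 0.\<close>
  ultimately have "K mx 0 z = 0" for z
    using obtain_lift[of z] residue_pairing_eq[of 0 _ mx] by (metis mult_zero_left)
  moreover from this have "K mx w 0 = 0" for w
    by (subst pairing_symmetric) (auto intro: fls_eqI)
  ultimately show "K mx (laurent_scale sc c w) z = c * K mx w z"
    "K mx w (laurent_scale sc c z) = hbar_flip c * K mx w z"
    using pairing_linear_left[of mx c w 0 z] pairing_linear_right[of mx w c z 0] by simp_all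
qed

text \<open>This is (H3). Flipping the second factor changes the sign of its hbar^-1
  \<open>u \<alpha>\<close> term, which cancels the one from the first factor; the Leibniz rule
  remains.\<close>

lemma pairing_nabla:
  "fls_map (mps_deriv \<alpha>) (K mx w1 w2) = K mx (nabla d G u \<Phi> \<alpha> w1) w2 + K mx w1 (nabla d G u \<Phi> \<alpha> w2)"
proof -
  obtain v1 v2 where v: "v1 \<in> LR" "w1 = Phi_laurent d G \<Phi> v1" "v2 \<in> LR" "w2 = Phi_laurent d G \<Phi> v2"
    by (metis obtain_lift)
  have "nabla_rep \<alpha> v1 * hbar_flip v2 + v1 * hbar_flip (nabla_rep \<alpha> v2) =
      fls_map (mps_deriv \<alpha>) (v1 * hbar_flip v2)"
    by (simp add: nabla_rep_def hbar_flip_add hbar_flip_mult hbar_flip_fls_map[OF additive_mps_deriv]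
        fls_map_mult_derivation[OF additive_mps_deriv mps_deriv_mult] algebra_simps)
  then show ?thesis
    using v by (simp add: nabla_eq residue_pairing_eq nabla_rep_closed[OF R] coef_add[symmetric]
        series_map_mps_deriv[OF additive_coef])
qed

text \<open>This is (H4). S + L is free of hbar, so its two terms cancel in the difference, while
  the anticommutation of flip and derivative turns the difference into a Leibniz sum.\<close>

lemma pairing_nabla_hbar_inv:
  "hbar_inv_deriv (K mx w1 w2) = K mx (nabla_hbar_inv d G u \<Phi> w1) w2 - K mx w1 (nabla_hbar_inv d G u \<Phi> w2)"
proof -
  obtain v1 v2 where v: "v1 \<in> LR" "w1 = Phi_laurent d G \<Phi> v1" "v2 \<in> LR" "w2 = Phi_laurent d G \<Phi> v2"
    by (metis obtain_lift)
  have "nabla_hbar_inv_rep v1 * hbar_flip v2 - v1 * hbar_flip (nabla_hbar_inv_rep v2) =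
      hbar_inv_deriv (v1 * hbar_flip v2)"
    by (simp add: nabla_hbar_inv_rep_def hbar_flip_add hbar_flip_mult hbar_inv_deriv_mult
        hbar_inv_deriv_hbar_flip algebra_simps)
  then show ?thesis
    using v by (simp add: nabla_hbar_inv_eq residue_pairing_eq nabla_hbar_inv_rep_closed[OF R]
        coef_diff[symmetric] series_map_hbar_inv_deriv[OF additive_coef])
qed

lemma pairing_power_series:
  assumes "\<forall>j<0. fls_nth w1 j = 0" "\<forall>j<0. fls_nth w2 j = 0"
  shows "(\<forall>j<0. fls_nth (K mx w1 w2) j = 0) \<and>
    fls_nth (K mx w1 w2) 0 = eta_pairing d G u mx \<Phi> (fls_nth w1 0) (fls_nth w2 0)"
proof -
  \<comment> \<open>These particular representatives inherit the absence of negative powers from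
    \<open>w1\<close> and \<open>w2\<close>, because \<open>lift 0 = 0\<close>.\<close>
  define v1 v2 where "v1 = series_map lift w1" and "v2 = series_map lift w2"
  have v: "v1 \<in> LR" "w1 = Phi_laurent d G \<Phi> v1" "v2 \<in> LR" "w2 = Phi_laurent d G \<Phi> v2"
    by (simp_all add: v1_def v2_def series_map_lift)
  have 0: "fls_nth v1 j = 0" "fls_nth v2 j = 0" if "j < 0" for j
    using that assms by (simp_all add: v1_def v2_def fls_nth_series_map mps_map_0)
  \<comment> \<open>The range is empty for negative \<open>j\<close> and has a single term for
    \<open>j = 0\<close>, where the flip acts trivially.\<close>
  have prod: "fls_nth (v1 * hbar_flip v2) j = (\<Sum>i=0..j. fls_nth v1 i * fls_nth (hbar_flip v2) (j - i))" for j
    using fls_times_nth_bounds[of 0 v1 0 "hbar_flip v2" j] 0 by simp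
  have power: "fls_nth v1 0 \<in> power_over R" "fls_nth v2 0 \<in> power_over R"
    using v by (simp_all add: laurent_over_def)
  have "fls_nth w1 0 = Phi_power d G \<Phi> (fls_nth v1 0)" "fls_nth w2 0 = Phi_power d G \<Phi> (fls_nth v2 0)"
    using v power by (simp_all add: Phi_laurent_eq Phi_power_eq fls_nth_series_map)
  then show ?thesis
    using v power
    by (simp add: residue_pairing_eq fls_nth_series_map prod mps_map_0 eta_pairing_eq del: fls_nth_hbar_flip)
       simp
qed

lemma residue_pairing_modified_higher_residue_pairing:
  "modified_higher_residue_pairing sc (nabla d G u \<Phi>) (nabla_hbar_inv d G u \<Phi>)
     (eta_pairing d G u mx \<Phi>) (residue_pairing d G u mx \<Phi>)"
proof -
  have "additive (mps_const :: complex \<Rightarrow> ('i, complex) mps)"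
    by (intro additive.intro mps_eqI) (simp add: mps_const_def)
  \<comment> \<open>The flip passes through the embedding of constants, so the two flips in the
    second half of (H2) cancel.\<close>
  then have flip: "hbar_flip (fls_map mps_const (hbar_flip g)) = (fls_map mps_const g :: ('i, complex) mps fls)"
    for g :: "complex fls"
    by (simp add: hbar_flip_fls_map)
  show ?thesis
    unfolding modified_higher_residue_pairing_def
    by (intro conjI allI impI)
       (simp_all add: flip pairing_linear_left pairing_linear_right pairing_scale pairing_power_series
         pairing_nabla[symmetric] pairing_nabla_hbar_inv[symmetric] pairing_symmetric[symmetric])
qed

end

theorem theorem5p7:
  fixes n k :: nat
    and d :: "'k::{finite,linorder} \<Rightarrow> nat"
    and G :: "'k \<Rightarrow> 'n::{finite,linorder} cpoly"
    and sc :: "complex \<Rightarrow> 'h::ab_group_add \<Rightarrow> 'h"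
    and \<Phi> :: "('k + 'n) cpoly set \<Rightarrow> 'h"
    and u :: "'i::finite \<Rightarrow> ('k + 'n) cpoly"
    and mx :: 'i
  assumes "CARD('k) = k" and "CARD('n) = n + 1" and "n \<ge> k" and "k \<ge> 1"
    and "\<And>l. homogeneous_poly (d l) (G l)"
    and "smooth_complete_intersection G"
    and calabi_yau: "(\<Sum>l\<in>UNIV. d l) = n + 1"
    and "is_primitive_cohomology (n - k) G sc"
    and "jacobian_iso d G sc \<Phi>"
    and "jacobian_basis d G u"
    and "\<And>\<alpha>. \<exists>c. bv_of_poly (u \<alpha>) \<in> weight_piece c"
    and "\<And>\<alpha>. bv_of_poly (u \<alpha>) \<in> weight_piece (int (n - k)) \<longleftrightarrow> \<alpha> = mx"
  shows "(\<forall>u1\<in>laurent_over (A00 d). \<forall>u2\<in>laurent_over (A00 d).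
            \<exists>!A. expands_laurent d G u (u1 * hbar_flip u2) A) \<and>
         (\<forall>u1\<in>laurent_over (A00 d). \<forall>u2\<in>laurent_over (A00 d). \<forall>A.
            expands_laurent d G u (u1 * hbar_flip u2) A \<longrightarrow>
            residue_pairing d G u mx \<Phi> (Phi_laurent d G \<Phi> u1)
              (Phi_laurent d G \<Phi> u2) = A mx) \<and>
         modified_higher_residue_pairing sc (nabla d G u \<Phi>) (nabla_hbar_inv d G u \<Phi>)
           (eta_pairing d G u mx \<Phi>) (residue_pairing d G u mx \<Phi>)"
proof -
  \<comment> \<open>The vector space laws on \<open>'h\<close> are part of its being the primitive
    cohomology.\<close>
  have "vector_space sc"
    using \<open>is_primitive_cohomology (n - k) G sc\<close> by (simp add: is_primitive_cohomology_def)
  then interpret jacobian_ring d G sc \<Phi> u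
    by (rule jacobian_ring.intro[rotated]) fact+
  show ?thesis
    \<comment> \<open>Both claims on expansions reduce to \<open>expands_laurent_iff\<close>: the
      only family of coefficients is that of the coordinates, whose \<open>mx\<close> entry is the
      value of the pairing.\<close>
    using residue_pairing_modified_higher_residue_pairing
    by (simp add: expands_laurent_iff product_in_LR residue_pairing_eq)
qed

end
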